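(* With $Q:=q^{13}$, the following hold: $$2q^3E(q^{16})E(Q^8)U(2,13,q^8)=(3,2,139)-(12,4,35),$$ $$2q^{7}E(q^8)E(Q^{16})U(1,26,q^8)=(7,4,60)-(15,4,28),$$ $$2q^{9}E(q^8)E(Q^{16})=(9,8,48)-(17,6,25),$$ $$2q^5E(q^{16})E(Q^8)=(5,4,84)-(20,4,21),$$ $$2q^5E(q^8)E(Q^{16})U(1,26,q^8)^2=(5,4,84)+(21,10,21)-(13,0,32)-(20,4,21)=2q^5E(q^{16})E(Q^{8})-2q^{13}\psi(Q^8)\varphi(-q^8),$$ $$2qE(q^{16})E(Q^8)U(2,13,q^8)^2=(1,0,416)+(17,6,25)-(4,4,105)-(9,8,48)=2q\psi(q^8)\varphi(-Q^8)-2q^9E(q^8)E(Q^{16}),$$ $$\frac{(5,4,84)+(21,10,21)-(13,0,32)-(20,4,21)}{(1,0,416)+(17,6,25)-(4,4,105)-(9,8,48)}=\frac{(9,8,48)-(17,6,25)}{(5,4,84)-(20,4,21)}=\frac{(7,4,60)-(15,4,28)}{(3,2,139)-(12,4,35)}=q^4\frac{E(q^8)E(Q^{16})}{E(q^{16})E(Q^8)}.$$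
   Context: Let $|q|<1$, $(a;q)_\infty=\prod_{k\ge0}(1-aq^k)$, $(a;q)_n=\prod_{k=0}^{n-1}(1-aq^k)$. $G(q)=\sum_{n\ge0}\frac{q^{n^2}}{(q;q)_n}$, $H(q)=\sum_{n\ge0}\frac{q^{n(n+1)}}{(q;q)_n}$. For positive integers $r,s$, $U(r,s,q)=G(q^r)G(q^s)+q^{(s+r)/5}H(q^r)H(q^s)$ if $s+r\equiv0\pmod5$ and $U(r,s,q)=H(q^r)G(q^s)-q^{(s-r)/5}G(q^r)H(q^s)$ if $s-r\equiv0\pmod5$; $U(r,s,x)$ denotes this expression with $q$ replaced by $x$. $E(q)=(q;q)_\infty$, $\varphi(q)=\sum_{n\in\mathbb Z}q^{n^2}$, $\psi(q)=\sum_{n\ge0}q^{n(n+1)/2}$. For integers $a,b,c$ with $a,c>0$, $b^2-4ac<0$, $(a,b,c)$ denotes $\sum_{n,m=-\infty}^{\infty}q^{an^2+bnm+cm^2}$. *)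

theory Defs
  imports "HOL-Analysis.Analysis"
begin

text \<open>All functions below are used on the open unit disc; there every infinite sum and
  product occurring here converges absolutely.\<close>

definition qpoch :: "complex \<Rightarrow> complex \<Rightarrow> nat \<Rightarrow> complex" where
  "qpoch a q n = (\<Prod>k<n. 1 - a * q ^ k)"

definition qpoch_inf :: "complex \<Rightarrow> complex \<Rightarrow> complex" where
  "qpoch_inf a q = prodinf (\<lambda>k. 1 - a * q ^ k)"

definition rrG :: "complex \<Rightarrow> complex" where
  "rrG q = (\<Sum>n. q ^ (n\<^sup>2) / qpoch q q n)"

definition rrH :: "complex \<Rightarrow> complex" where
  "rrH q = (\<Sum>n. q ^ (n * (n + 1)) / qpoch q q n)"

text \<open>The exponent \<open>(s - r) / 5\<close> may be negative, hence the integer power in the second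
  branch. The function is only meaningful for positive \<open>r\<close>, \<open>s\<close> satisfying
  one of the two congruences, and is left unspecified if neither holds. If both hold
  (\<open>5\<close> divides \<open>r\<close> and \<open>s\<close>), the first branch is taken.\<close>

definition rrU :: "nat \<Rightarrow> nat \<Rightarrow> complex \<Rightarrow> complex" where
  "rrU r s x =
     (if 5 dvd (s + r) then
        rrG (x ^ r) * rrG (x ^ s) + x ^ ((s + r) div 5) * rrH (x ^ r) * rrH (x ^ s)
      else if 5 dvd (int s - int r) then
        rrH (x ^ r) * rrG (x ^ s) - x powi ((int s - int r) div 5) * rrG (x ^ r) * rrH (x ^ s)
      else undefined)"

definition eulerE :: "complex \<Rightarrow> complex" where
  "eulerE q = qpoch_inf q q"

definition ramphi :: "complex \<Rightarrow> complex" where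
  "ramphi q = (\<Sum>\<^sub>\<infinity>n\<in>(UNIV :: int set). q powi (n\<^sup>2))"

definition rampsi :: "complex \<Rightarrow> complex" where
  "rampsi q = (\<Sum>n. q ^ (n * (n + 1) div 2))"

text \<open>The series written \<open>(a, b, c)\<close>, for \<open>a, c > 0\<close> and \<open>b\<^sup>2 - 4ac < 0\<close>.
  The exponents are then non-negative.\<close>

definition bqseries :: "int \<Rightarrow> int \<Rightarrow> int \<Rightarrow> complex \<Rightarrow> complex" where
  "bqseries a b c q =
     (\<Sum>\<^sub>\<infinity>(n, m)\<in>(UNIV :: (int \<times> int) set). q powi (a * n\<^sup>2 + b * n * m + c * m\<^sup>2))"

text \<open>Numerators and denominators of three quotients of such series that are compared as
  meromorphic functions on the unit disc. The first and third denominators have zeros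
  \<open>q \<noteq> 0\<close> in the disc (where \<open>rrU 2 13 (q ^ 8) = 0\<close>, for instance at
  \<open>q ^ 8 = exp (2 * pi * \<i> * (5 + \<i>) / 26)\<close>), so an
  equality of quotients is to be read at those points where the denominators are nonzero;
  these are all points of the disc outside a sparse set.\<close>

definition num1 :: "complex \<Rightarrow> complex" where
  "num1 q = bqseries 5 4 84 q + bqseries 21 10 21 q - bqseries 13 0 32 q - bqseries 20 4 21 q"

definition den1 :: "complex \<Rightarrow> complex" where
  "den1 q = bqseries 1 0 416 q + bqseries 17 6 25 q - bqseries 4 4 105 q - bqseries 9 8 48 q"

definition num2 :: "complex \<Rightarrow> complex" where
  "num2 q = bqseries 9 8 48 q - bqseries 17 6 25 q"

definition den2 :: "complex \<Rightarrow> complex" where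
  "den2 q = bqseries 5 4 84 q - bqseries 20 4 21 q"

definition num3 :: "complex \<Rightarrow> complex" where
  "num3 q = bqseries 7 4 60 q - bqseries 15 4 28 q"

definition den3 :: "complex \<Rightarrow> complex" where
  "den3 q = bqseries 3 2 139 q - bqseries 12 4 35 q"

end

(*
  Let x = q^8 and y = Q^8, and write E_k, G_k, H_k for the functions at x^k. By the Rogers-Ramanujan
  identities, Jacobi's triple product and Euler's pentagonal number theorem, E, G E and H E are theta
  series. Hence E_2 E_13 U(2,13), E_1 E_26 U(1,26), E_1 E_26, E_2 E_13, psi(x) phi(-y) and
  psi(y) phi(-x) are double theta series, and linear changes of variables identify them with the
  differences of series (a,b,c) in the theorem.

  The formula for U(2,13)^2 comes from the 5-dissection E(z) = E_5 (G/H - z - z^2 H/G), z^5 = x: in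
  E(z^2) E(z^13) the terms with exponents divisible by 5 sum to
  E_10 E_65 (w + x^3 + x^6 / w) with w = G_2 G_13 / (H_2 H_13), and w + 2 x^3 + x^6 / w is
  (G_2 G_13 + x^3 H_2 H_13)^2 / (G_2 G_13 H_2 H_13). U(1,26)^2 is treated in the same way.

  The equality U(1,26) = U(2,13) comes from writing E_2 E_13 U(2,13) and E_1 E_26 U(1,26) as
  combinations of two products of theta series modulo 3 each; these products correspond to each other
  by psi(x^3) E(x) = f(-x,-x^5) E(x^2) and phi(-x^3) E(x^2) = f(x,x^2) E(x), where f is
  Ramanujan's general theta function.
*)

theory Submission
  imports Defs "HOL-Complex_Analysis.Complex_Analysis"
begin

section \<open>One-dimensional theta series and binary forms\<close>

text \<open>Every form in the theorem has discriminant -1664. On passing to the sums over odd k it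
  becomes a form f(k, r) of discriminant -416 = -16 A B with A B = 26, and h f = A s^2 + B k^2 with
  s = \<mu> k + 2 h r is possible once h divides A \<mu>^2 + B. The modulus h decides which product
  appears: h = 3 gives the pentagonal series of E, h = 5 the series of G E and H E, and h = 15 the
  parts of the 5-dissection of E. The obstacle is the odd k divisible by 3 or 5, which do not fit
  such a product. For h = 3 and h = 5 they cancel within a single form by an involution. For h = 15
  the multiples of 5 are the wanted middle term, but those of 3 cancel only between two forms; this
  is why a square of U needs two differences of series. The two forms belong to values of \<mu> that
  agree modulo 3 and are opposite modulo 5: one supplies the diagonal terms and the other the cross
  terms of the products of dissection parts.\<close>

text \<open>Series in \<open>x\<close> are written in a square root \<open>t\<close> of \<open>x\<close>, which keeps exponents such as \<open>n (3 n + 1) / 2\<close> integral.\<close>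

definition theta :: "int \<Rightarrow> int \<Rightarrow> complex \<Rightarrow> complex \<Rightarrow> complex" where
  "theta a b s t = (\<Sum>\<^sub>\<infinity>n. s powi n * t powi (a * n\<^sup>2 + b * n))"

lemma summable_on_geometric_int:
  fixes r :: real
  assumes "0 \<le> r" "r < 1"
  shows "(\<lambda>n::int. r ^ nat \<bar>n\<bar>) summable_on UNIV"
proof -
  have g: "(\<lambda>n::nat. r ^ n) summable_on UNIV"
    using assms by (intro norm_summable_imp_summable_on) (auto simp: summable_geometric)
  have "(\<lambda>n::int. r ^ nat \<bar>n\<bar>) summable_on range int"
    by (subst summable_on_reindex) (auto simp: o_def g)
  moreover have "(\<lambda>n::int. r ^ nat \<bar>n\<bar>) summable_on range (\<lambda>n. - int n)"
    by (subst summable_on_reindex) (auto simp: o_def g inj_on_def)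
  ultimately have "(\<lambda>n::int. r ^ nat \<bar>n\<bar>) summable_on (range int \<union> range (\<lambda>n. - int n))"
    by (rule summable_on_union)
  also have "range int \<union> range (\<lambda>n. - int n) = UNIV"
    by (auto simp: image_iff) (metis int_cases2)
  finally show ?thesis .
qed

lemma theta_summable:
  fixes s t :: complex
  assumes "norm s = 1" "norm t < 1" "t \<noteq> 0" "a > 0"
  shows "(\<lambda>n. norm (s powi n * t powi (a * n\<^sup>2 + b * n))) summable_on UNIV"
proof -
  \<comment> \<open>For \<open>a\<close> at least 1, completing the square bounds the exponent below
    by |n| - C; this crude linear bound is enough for comparison with a geometric series.\<close>
  define C where "C = (\<bar>b\<bar> + 1)\<^sup>2"
  have e: "a * n\<^sup>2 + b * n \<ge> \<bar>n\<bar> - C" for n :: int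
  proof -
    have "a * n\<^sup>2 \<ge> 1 * n\<^sup>2" by (rule mult_right_mono) (use assms in auto)
    moreover have "b * n \<ge> - (\<bar>b\<bar> * \<bar>n\<bar>)" by (metis abs_ge_minus_self abs_mult minus_le_iff)
    moreover have "\<bar>n\<bar>\<^sup>2 - (\<bar>b\<bar> + 1) * \<bar>n\<bar> + (\<bar>b\<bar> + 1)\<^sup>2 \<ge> 0" 
    proof -
      have "4 * (\<bar>n\<bar>\<^sup>2 - (\<bar>b\<bar> + 1) * \<bar>n\<bar> + (\<bar>b\<bar> + 1)\<^sup>2) = (2 * \<bar>n\<bar> - (\<bar>b\<bar> + 1))\<^sup>2 + 3 * (\<bar>b\<bar> + 1)\<^sup>2"
        by (simp add: power2_eq_square algebra_simps)
      also have "\<dots> \<ge> 0" by simp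
      finally show ?thesis by simp
    qed
    ultimately show ?thesis unfolding C_def by (simp add: algebra_simps)
  qed
  have "(\<lambda>n. norm t powi (- C) * norm t ^ nat \<bar>n\<bar>) summable_on (UNIV :: int set)"
    by (intro summable_on_cmult_right summable_on_geometric_int) (use assms in auto)
  then show ?thesis
  proof (rule summable_on_comparison_test)
    fix n :: int
    have "norm (s powi n * t powi (a * n\<^sup>2 + b * n)) = norm t powi (a * n\<^sup>2 + b * n)"
      by (simp only: norm_mult norm_power_int assms power_int_1_left mult_1_left)
    also have "\<dots> \<le> norm t powi (\<bar>n\<bar> - C)"
      by (rule power_int_decreasing) (use e assms in auto)
    also have "\<dots> = norm t powi (- C) * norm t ^ nat \<bar>n\<bar>"
    proof -
      have "norm t powi (\<bar>n\<bar> - C) = norm t powi (- C) * norm t powi int (nat \<bar>n\<bar>)"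
        using assms(3) by (subst power_int_add[symmetric]) auto
      then show ?thesis by (simp only: power_int_of_nat)
    qed
    finally show "norm (s powi n * t powi (a * n\<^sup>2 + b * n)) \<le> norm t powi (- C) * norm t ^ nat \<bar>n\<bar>" .
  qed (rule norm_ge_zero)
qed

lemma norm_summable_product:
  fixes f g :: "int \<Rightarrow> complex"
  assumes "(\<lambda>n. norm (f n)) summable_on UNIV" "(\<lambda>n. norm (g n)) summable_on UNIV"
  shows "(\<lambda>(n, m). norm (f n * g m)) summable_on UNIV"
proof -
  have "(\<lambda>(n, m). norm (f n * g m)) summable_on (UNIV \<times> UNIV)"
  proof (rule summable_on_SigmaI)
    show "((\<lambda>m. (\<lambda>(n, m). norm (f n * g m)) (n, m)) has_sum norm (f n) * (\<Sum>\<^sub>\<infinity>m. norm (g m))) UNIV" for n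
      using has_sum_cmult_right[OF has_sum_infsum[OF assms(2)], of "norm (f n)"] by (simp add: norm_mult)
    show "(\<lambda>n. norm (f n) * (\<Sum>\<^sub>\<infinity>m. norm (g m))) summable_on UNIV"
      by (rule summable_on_cmult_left[OF assms(1)])
  qed auto
  then show ?thesis by simp
qed

lemma infsum_product:
  fixes f g :: "int \<Rightarrow> complex"
  assumes "(\<lambda>n. norm (f n)) summable_on UNIV" "(\<lambda>n. norm (g n)) summable_on UNIV"
  shows "infsum f UNIV * infsum g UNIV = (\<Sum>\<^sub>\<infinity>(n, m). f n * g m)"
proof -
  have "(\<lambda>x. norm (case x of (n, m) \<Rightarrow> f n * g m)) summable_on (UNIV \<times> UNIV)"
    using norm_summable_product[OF assms] by (simp add: case_prod_unfold)
  then have "(\<lambda>(n, m). f n * g m) summable_on (UNIV \<times> UNIV)"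
    by (rule abs_summable_summable)
  then have "(\<Sum>\<^sub>\<infinity>(n, m). f n * g m) = (\<Sum>\<^sub>\<infinity>n. \<Sum>\<^sub>\<infinity>m. f n * g m)"
    by (subst infsum_Sigma'_banach) simp_all
  also have "\<dots> = (\<Sum>\<^sub>\<infinity>n. f n * infsum g UNIV)"
    by (simp only: infsum_cmult_right')
  also have "\<dots> = infsum f UNIV * infsum g UNIV"
    by (simp only: infsum_cmult_left')
  finally show ?thesis by (rule sym)
qed

lemma theta_product:
  assumes "norm s = 1" "norm s' = 1" "norm t < 1" "t \<noteq> 0" "norm t' < 1" "t' \<noteq> 0" "a > 0" "a' > 0"
  shows "theta a b s t * theta a' b' s' t' =
    (\<Sum>\<^sub>\<infinity>(n, m). s powi n * s' powi m * (t powi (a * n\<^sup>2 + b * n) * t' powi (a' * m\<^sup>2 + b' * m)))"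
proof -
  have "theta a b s t * theta a' b' s' t' =
    (\<Sum>\<^sub>\<infinity>(n, m). s powi n * t powi (a * n\<^sup>2 + b * n) * (s' powi m * t' powi (a' * m\<^sup>2 + b' * m)))"
    unfolding theta_def by (intro infsum_product theta_summable assms)
  then show ?thesis by (simp add: mult_ac)
qed

lemma theta_product_summable:
  fixes s s' t t' :: complex
  assumes "norm s = 1" "norm s' = 1" "norm t < 1" "t \<noteq> 0" "norm t' < 1" "t' \<noteq> 0" "a > 0" "a' > 0"
  shows "(\<lambda>(n, m). s powi n * s' powi m * (t powi (a * n\<^sup>2 + b * n) * t' powi (a' * m\<^sup>2 + b' * m)))
     summable_on UNIV"
proof -
  have "(\<lambda>(n, m). norm (s powi n * t powi (a * n\<^sup>2 + b * n) * (s' powi m * t' powi (a' * m\<^sup>2 + b' * m)))) summable_on UNIV"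
    by (intro norm_summable_product theta_summable assms)
  then have "(\<lambda>x. norm (case x of (n, m) \<Rightarrow> s powi n * s' powi m * (t powi (a * n\<^sup>2 + b * n) * t' powi (a' * m\<^sup>2 + b' * m))))
     summable_on UNIV"
    by (simp add: case_prod_unfold mult_ac)
  then show ?thesis by (rule abs_summable_summable)
qed

lemma theta_power:
  "theta a b s (t ^ k) = theta (int k * a) (int k * b) s t"
  unfolding theta_def by (simp add: power_int_power algebra_simps)

lemma theta_neg: "theta a (- b) s t = theta a b (inverse s) t"
  unfolding theta_def
  by (rule infsum_reindex_bij_witness[of _ uminus uminus]) (auto simp: power_int_minus power_int_inverse)

section \<open>Convergence of sums over positive definite binary forms\<close>

text \<open>Adding the completed squares of 4a times the form and of 4c times the form leaves (4ac -
  b^2)(n^2 + m^2), and over the integers 4ac - b^2 is at least 1.\<close>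

lemma form_lower_bound:
  fixes a b c n m :: int
  assumes "a > 0" "b\<^sup>2 < 4 * a * c"
  shows "4 * (a + c) * (a * n\<^sup>2 + b * n * m + c * m\<^sup>2) \<ge> n\<^sup>2 + m\<^sup>2"
proof -
  have "4 * (a + c) * (a * n\<^sup>2 + b * n * m + c * m\<^sup>2) =
      (2 * a * n + b * m)\<^sup>2 + (2 * c * m + b * n)\<^sup>2 + (4 * a * c - b\<^sup>2) * (n\<^sup>2 + m\<^sup>2)"
    by (simp add: power2_eq_square algebra_simps)
  also have "\<dots> \<ge> 0 + 0 + 1 * (n\<^sup>2 + m\<^sup>2)"
    by (intro add_mono mult_right_mono) (use assms in auto)
  finally show ?thesis by simp
qed

lemma form_summable:
  fixes q :: complex
  assumes "a > 0" "b\<^sup>2 < 4 * a * c" "norm q < 1" "q \<noteq> 0"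
  shows "(\<lambda>(n, m). norm (q powi (a * n\<^sup>2 + b * n * m + c * m\<^sup>2))) summable_on (UNIV :: (int \<times> int) set)"
proof -
  have "a * c > 0"
    using assms(2) zero_le_power2[of b] by linarith
  then have "c > 0" using assms(1) by (simp add: zero_less_mult_iff)
  define N where "N = nat (4 * (a + c))"
  have N: "int N = 4 * (a + c)" "N > 0" using assms(1) \<open>c > 0\<close> by (auto simp: N_def)
  \<comment> \<open>The lower bound has denominator 4(a + c). Passing to this root of |q| keeps all
    exponents integral.\<close>
  define r where "r = root N (norm q)"
  have rN: "r ^ N = norm q" using N by (simp add: r_def)
  have r: "0 < r" "r < 1" using N assms by (auto simp: r_def)
  have "norm (q powi (a * n\<^sup>2 + b * n * m + c * m\<^sup>2)) \<le> r ^ nat \<bar>n\<bar> * r ^ nat \<bar>m\<bar>" for n m :: int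
  proof -
    have sq: "\<bar>k\<bar> \<le> k\<^sup>2" for k :: int
      using self_le_power[of "\<bar>k\<bar>" 2] by (cases "k = 0") auto
    have "norm (q powi (a * n\<^sup>2 + b * n * m + c * m\<^sup>2)) = r powi (4 * (a + c) * (a * n\<^sup>2 + b * n * m + c * m\<^sup>2))"
      by (simp only: norm_power_int rN[symmetric] power_int_power N)
    also have "\<dots> \<le> r powi (\<bar>n\<bar> + \<bar>m\<bar>)"
      using form_lower_bound[OF assms(1,2), of n m] sq[of n] sq[of m] r
      by (intro power_int_decreasing) auto
    also have "\<dots> = r ^ nat \<bar>n\<bar> * r ^ nat \<bar>m\<bar>"
    proof -
      have "r powi (\<bar>n\<bar> + \<bar>m\<bar>) = r powi int (nat \<bar>n\<bar>) * r powi int (nat \<bar>m\<bar>)"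
        using r by (subst power_int_add[symmetric]) auto
      then show ?thesis by (simp only: power_int_of_nat)
    qed
    finally show ?thesis .
  qed
  moreover have "(\<lambda>(n::int, m::int). norm (complex_of_real (r ^ nat \<bar>n\<bar>) * complex_of_real (r ^ nat \<bar>m\<bar>))) summable_on UNIV"
    by (rule norm_summable_product) (use r summable_on_geometric_int[of r] in \<open>auto simp: norm_power\<close>)
  ultimately show ?thesis
    by (elim summable_on_comparison_test) (use r in \<open>auto simp: norm_mult norm_power\<close>)
qed

section \<open>Alternating sums over binary forms and their residue classes\<close>

lemma minus_one_powi_cong:
  assumes "even (a - b)"
  shows "(- 1 :: complex) powi a = (- 1) powi b"
proof -
  obtain k where "a = b + 2 * k" using assms by (metis add.commute diff_add_cancel evenE)
  then show ?thesis by (simp add: power_int_add power_int_mult)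
qed

lemma infsum_residues:
  fixes f :: "int \<times> int \<Rightarrow> complex"
  assumes "f summable_on UNIV" "L > 0"
  shows "infsum f UNIV = (\<Sum>l\<in>{0..<L}. \<Sum>\<^sub>\<infinity>(m, r). f (L * m + l, r))"
proof -
  let ?g = "\<lambda>(l, m, r). f (L * m + l, r)"
  let ?i = "\<lambda>(l, m, r). (L * m + l, r)" and ?j = "\<lambda>(k, r). (k mod L, k div L, r)"
  have w: "?i (?j z) = z" "?j z \<in> {0..<L} \<times> UNIV" "?g (?j z) = f z" for z :: "int \<times> int"
    using assms(2) by (auto split: prod.splits)
  have w': "?j (?i z) = z" if "z \<in> {0..<L} \<times> UNIV" for z :: "int \<times> int \<times> int"
    using that assms(2) by (auto split: prod.splits)
  have eq: "infsum f UNIV = infsum ?g ({0..<L} \<times> UNIV)"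
    by (rule infsum_reindex_bij_witness[of _ ?i ?j]) (use w w' in auto)
  have "f summable_on UNIV \<longleftrightarrow> ?g summable_on ({0..<L} \<times> UNIV)"
    by (rule summable_on_reindex_bij_witness[of _ ?i ?j]) (use w w' in auto)
  with assms have "?g summable_on ({0..<L} \<times> UNIV)" by simp
  from infsum_Sigma_banach[OF this] show ?thesis unfolding eq by simp
qed

text \<open>With \<open>k = M m + i\<close> the sum runs over a residue class of \<open>k\<close>. For odd \<open>k\<close> (\<open>M = 2\<close>, \<open>i = 1\<close>) it is the
  difference of two of the series \<open>(a, b, c)\<close>, see \<open>bqseries_diff\<close>; all six differences of the theorem are
  of this kind.\<close>

definition alt_bqseries :: "int \<Rightarrow> int \<Rightarrow> int \<Rightarrow> int \<Rightarrow> int \<Rightarrow> complex \<Rightarrow> complex" where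
  "alt_bqseries M i a b c q =
     (\<Sum>\<^sub>\<infinity>(m, r). (- 1) powi r * q powi (a * (M * m + i)\<^sup>2 + b * (M * m + i) * r + c * r\<^sup>2))"

lemma alt_bqseries_shift: "alt_bqseries M (i + M) a b c q = alt_bqseries M i a b c q"
  unfolding alt_bqseries_def
  by (rule infsum_reindex_bij_witness[of _ "\<lambda>(m, r). (m - 1, r)" "\<lambda>(m, r). (m + 1, r)"])
     (auto simp: algebra_simps)

lemma alt_bqseries_neg: "alt_bqseries M (- i) a b c q = alt_bqseries M i a b c q"
  unfolding alt_bqseries_def
proof (rule infsum_reindex_bij_witness[of _ "\<lambda>(m, r). (- m, - r)" "\<lambda>(m, r). (- m, - r)"], goal_cases)
  case (5 x)
  obtain m r where x: "x = (m, r)" by force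
  have "(- 1 :: complex) powi (- r) = (- 1) powi r" by (rule minus_one_powi_cong) simp
  moreover have "a * (M * - m + i)\<^sup>2 + b * (M * - m + i) * - r + c * (- r)\<^sup>2 =
    a * (M * m + - i)\<^sup>2 + b * (M * m + - i) * r + c * r\<^sup>2" by algebra
  ultimately show ?case by (simp only: x prod.case)
qed auto

lemma alt_bqseries_reflect: "alt_bqseries M i a (- b) c q = alt_bqseries M i a b c q"
  unfolding alt_bqseries_def
proof (rule infsum_reindex_bij_witness[of _ "\<lambda>(m, r). (m, - r)" "\<lambda>(m, r). (m, - r)"], goal_cases)
  case (5 x)
  obtain m r where x: "x = (m, r)" by force
  have "(- 1 :: complex) powi (- r) = (- 1) powi r" by (rule minus_one_powi_cong) simp
  moreover have "a * (M * m + i)\<^sup>2 + b * (M * m + i) * - r + c * (- r)\<^sup>2 =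
    a * (M * m + i)\<^sup>2 + - b * (M * m + i) * r + c * r\<^sup>2" by algebra
  ultimately show ?case by (simp only: x prod.case)
qed auto

text \<open>Substitute r - e k for r. The sign changes by (-1)^(e k), which is the constant (-1)^e
  because every k is odd.\<close>

lemma alt_bqseries_shear:
  assumes "even M" "odd i"
  shows "alt_bqseries M i a b c q = (- 1) powi e * alt_bqseries M i (a + e * b + e\<^sup>2 * c) (b + 2 * e * c) c q"
  unfolding alt_bqseries_def infsum_cmult_right'[symmetric]
proof (rule infsum_reindex_bij_witness[of _ "\<lambda>(m, r). (m, r + e * (M * m + i))" "\<lambda>(m, r). (m, r - e * (M * m + i))"], goal_cases)
  case (5 x)
  obtain m r where x: "x = (m, r)" by force
  have "(- 1 :: complex) powi e * (- 1) powi (r - e * (M * m + i)) = (- 1) powi (e + (r - e * (M * m + i)))"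
    by (simp add: power_int_add)
  also have "\<dots> = (- 1) powi r" by (rule minus_one_powi_cong) (use assms in auto)
  finally have s: "(- 1 :: complex) powi e * (- 1) powi (r - e * (M * m + i)) = (- 1) powi r" .
  have "(a + e * b + e\<^sup>2 * c) * (M * m + i)\<^sup>2 + (b + 2 * e * c) * (M * m + i) * (r - e * (M * m + i)) + c * (r - e * (M * m + i))\<^sup>2 =
    a * (M * m + i)\<^sup>2 + b * (M * m + i) * r + c * r\<^sup>2" by algebra
  then show ?case by (simp only: x prod.case mult.assoc[symmetric] s)
qed auto

text \<open>Substituting k - 2r for k keeps k odd and leaves the sign alone. Together with
  \<open>alt_bqseries_shear\<close> and \<open>alt_bqseries_reflect\<close> this moves between
  equivalent forms; a change of variables that disturbs the parity of k would not be
  allowed.\<close>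

lemma alt_bqseries_add_even: "alt_bqseries 2 1 a b c q = alt_bqseries 2 1 a (b + 4 * a) (4 * a + 2 * b + c) q"
  unfolding alt_bqseries_def
proof (rule infsum_reindex_bij_witness[of _ "\<lambda>(m, r). (m + r, r)" "\<lambda>(m, r). (m - r, r)"], goal_cases)
  case (5 x)
  obtain m r where x: "x = (m, r)" by force
  have "a * (2 * (m - r) + 1)\<^sup>2 + (b + 4 * a) * (2 * (m - r) + 1) * r + (4 * a + 2 * b + c) * r\<^sup>2 =
    a * (2 * m + 1)\<^sup>2 + b * (2 * m + 1) * r + c * r\<^sup>2" by algebra
  then show ?case by (simp only: x prod.case)
qed auto

text \<open>The map \<open>r \<mapsto> - r - e k / N\<close> preserves the form and changes the sign.\<close>

lemma alt_bqseries_vanish: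
  assumes "odd N" "odd e" "c * e = N * b"
  shows "alt_bqseries (2 * N) N a b c q = 0"
proof -
  have "alt_bqseries (2 * N) N a b c q = - alt_bqseries (2 * N) N a b c q"
    unfolding alt_bqseries_def infsum_uminus[symmetric]
  proof (rule infsum_reindex_bij_witness[of _ "\<lambda>(m, r). (m, - r - e * (2 * m + 1))" "\<lambda>(m, r). (m, - r - e * (2 * m + 1))"], goal_cases)
    case (5 x)
    obtain m r where x: "x = (m, r)" by force
    have "- ((- 1 :: complex) powi (- r - e * (2 * m + 1))) = (- 1) powi (1 + (- r - e * (2 * m + 1)))"
      by (simp add: power_int_add)
    also have "\<dots> = (- 1) powi r" by (rule minus_one_powi_cong) (use assms in auto)
    finally have s: "- ((- 1 :: complex) powi (- r - e * (2 * m + 1))) = (- 1) powi r" .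
    have "a * (2 * N * m + N)\<^sup>2 + b * (2 * N * m + N) * (- r - e * (2 * m + 1)) + c * (- r - e * (2 * m + 1))\<^sup>2 =
      a * (2 * N * m + N)\<^sup>2 + b * (2 * N * m + N) * r + c * r\<^sup>2"
      using assms(3) by algebra
    then show ?case by (simp only: x prod.case mult_minus_left[symmetric] s)
  qed auto
  then show ?thesis by simp
qed

lemma alt_bqseries_summable:
  assumes "a > 0" "b\<^sup>2 < 4 * a * c" "norm q < 1" "q \<noteq> 0" "M \<noteq> 0"
  shows "(\<lambda>(m, r). (- 1 :: complex) powi r * q powi (a * (M * m + i)\<^sup>2 + b * (M * m + i) * r + c * r\<^sup>2)) summable_on UNIV"
proof -
  let ?f = "\<lambda>(n, m). norm (q powi (a * n\<^sup>2 + b * n * m + c * m\<^sup>2))"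
  let ?h = "\<lambda>(m, r). (M * m + i, r :: int)"
  have inj: "inj ?h" using assms(5) by (auto simp: inj_on_def)
  have "?f summable_on range ?h"
    by (rule summable_on_subset_banach[OF form_summable[OF assms(1-4)]]) auto
  then have "(\<lambda>x. norm (case x of (m, r) \<Rightarrow> (- 1 :: complex) powi r * q powi (a * (M * m + i)\<^sup>2 + b * (M * m + i) * r + c * r\<^sup>2))) summable_on UNIV"
    by (subst (asm) summable_on_reindex[OF inj]) (simp add: o_def case_prod_unfold norm_mult norm_power_int)
  then show ?thesis by (rule abs_summable_summable)
qed

lemma alt_bqseries_refine:
  assumes "a > 0" "b\<^sup>2 < 4 * a * c" "norm q < 1" "q \<noteq> 0" "M \<noteq> 0" "L > 0"
  shows "alt_bqseries M i a b c q = (\<Sum>l\<in>{0..<L}. alt_bqseries (M * L) (i + M * l) a b c q)"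
  unfolding alt_bqseries_def
  by (subst infsum_residues[OF alt_bqseries_summable[OF assms(1-5)] assms(6)]) (simp add: algebra_simps)

lemma atLeastLessThan_int_2_3_5: "{0..<3::int} = {0, 1, 2}" "{0..<5::int} = {0, 1, 2, 3, 4}" "{0..<2::int} = {0, 1}"
  by auto

text \<open>Changing the signs of k and r together fixes every term and exchanges the classes 1 and
  -1 modulo 6. This is the origin of the factor 2 in all the product formulas.\<close>

lemma alt_bqseries_2_6:
  assumes "a > 0" "b\<^sup>2 < 4 * a * c" "norm q < 1" "q \<noteq> 0"
  shows "alt_bqseries 2 1 a b c q = 2 * alt_bqseries 6 1 a b c q + alt_bqseries 6 3 a b c q"
proof -
  have "alt_bqseries 6 5 a b c q = alt_bqseries 6 1 a b c q"
    using alt_bqseries_shift[of 6 "-1" a b c q] alt_bqseries_neg[of 6 1 a b c q] by simp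
  with alt_bqseries_refine[OF assms, of 2 3 1] show ?thesis
    by (simp add: atLeastLessThan_int_2_3_5)
qed

lemma alt_bqseries_2_10:
  assumes "a > 0" "b\<^sup>2 < 4 * a * c" "norm q < 1" "q \<noteq> 0"
  shows "alt_bqseries 2 1 a b c q = 2 * (alt_bqseries 10 1 a b c q + alt_bqseries 10 3 a b c q) + alt_bqseries 10 5 a b c q"
proof -
  have "alt_bqseries 10 9 a b c q = alt_bqseries 10 1 a b c q" "alt_bqseries 10 7 a b c q = alt_bqseries 10 3 a b c q"
    using alt_bqseries_shift[of 10 "-1" a b c q] alt_bqseries_neg[of 10 1 a b c q] 
      alt_bqseries_shift[of 10 "-3" a b c q] alt_bqseries_neg[of 10 3 a b c q] by simp_all
  with alt_bqseries_refine[OF assms, of 2 5 1] show ?thesis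
    by (simp add: atLeastLessThan_int_2_3_5)
qed

text \<open>The class 1 modulo 6 is split modulo 5; its multiples of 5 are the class -5 modulo
  30.\<close>

lemma alt_bqseries_6_30:
  assumes "a > 0" "b\<^sup>2 < 4 * a * c" "norm q < 1" "q \<noteq> 0"
  shows "alt_bqseries 6 1 a b c q = alt_bqseries 30 1 a b c q + alt_bqseries 30 7 a b c q + alt_bqseries 30 13 a b c q
    + alt_bqseries 30 (- 11) a b c q + alt_bqseries 30 (- 5) a b c q"
proof -
  have "alt_bqseries 30 19 a b c q = alt_bqseries 30 (- 11) a b c q" "alt_bqseries 30 25 a b c q = alt_bqseries 30 (- 5) a b c q"
    using alt_bqseries_shift[of 30 "-11" a b c q] alt_bqseries_shift[of 30 "-5" a b c q] by simp_all
  with alt_bqseries_refine[OF assms, of 6 5 1] show ?thesis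
    by (simp add: atLeastLessThan_int_2_3_5)
qed

text \<open>The form on the right is \<open>(A s\<^sup>2 + B k\<^sup>2) / h\<close> with \<open>s = \<mu> k + 2 h r\<close>.\<close>

lemma theta_theta_eq_alt_bqseries:
  assumes "h * a = A * \<mu>\<^sup>2 + B" "\<mu> * i = i' + 2 * h * d" "odd \<mu>" "h * e = A * i'\<^sup>2 + B * i\<^sup>2"
    and "norm q < 1" "q \<noteq> 0" "A > 0" "B > 0" "h > 0"
  shows "alt_bqseries (2 * h) i a (4 * A * \<mu>) (4 * h * A) q = (- 1) powi d * q powi e *
    (theta (4 * A * h) (4 * A * i') (- 1) q * theta (4 * B * h) (4 * B * i) (- 1) q)"
proof -
  have "alt_bqseries (2 * h) i a (4 * A * \<mu>) (4 * h * A) q = ((- 1) powi d * q powi e) *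
    (\<Sum>\<^sub>\<infinity>(n, m). (- 1) powi n * (- 1) powi m * (q powi (4 * A * h * n\<^sup>2 + 4 * A * i' * n) * q powi (4 * B * h * m\<^sup>2 + 4 * B * i * m)))"
    unfolding alt_bqseries_def infsum_cmult_right'[symmetric]
  \<comment> \<open>Since s = \<mu> k + 2hr equals 2hn + i' for n = \<mu> m + r + d, the indices n
    and m vary independently, and \<open>e\<close> collects the constant terms. Odd \<mu> makes the
    sign split as (-1)^n (-1)^m up to (-1)^d.\<close>
  proof (rule infsum_reindex_bij_witness[of _ "\<lambda>(n, m). (m, n - \<mu> * m - d)" "\<lambda>(m, r). (\<mu> * m + r + d, m)"], goal_cases)
    case (5 x)
    obtain m r where x: "x = (m, r)" by force
    have "(- 1 :: complex) powi d * ((- 1) powi (\<mu> * m + r + d) * (- 1) powi m) = (- 1) powi (d + ((\<mu> * m + r + d) + m))"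
      by (simp add: power_int_add)
    also have "\<dots> = (- 1) powi r"
      by (rule minus_one_powi_cong) (use assms(3) in auto)
    finally have s: "(- 1 :: complex) powi d * ((- 1) powi (\<mu> * m + r + d) * (- 1) powi m) = (- 1) powi r" .
    have i': "i' = \<mu> * i - 2 * h * d" using assms(2) by simp
    have "h * (e + (4 * A * h * (\<mu> * m + r + d)\<^sup>2 + 4 * A * i' * (\<mu> * m + r + d) + (4 * B * h * m\<^sup>2 + 4 * B * i * m))) =
      h * (a * (2 * h * m + i)\<^sup>2 + 4 * A * \<mu> * (2 * h * m + i) * r + 4 * h * A * r\<^sup>2)"
      using assms(1,4) unfolding i' by algebra
    then have "e + (4 * A * h * (\<mu> * m + r + d)\<^sup>2 + 4 * A * i' * (\<mu> * m + r + d) + (4 * B * h * m\<^sup>2 + 4 * B * i * m)) =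
      a * (2 * h * m + i)\<^sup>2 + 4 * A * \<mu> * (2 * h * m + i) * r + 4 * h * A * r\<^sup>2"
      using assms(9) by simp
    then have p: "q powi e * (q powi (4 * A * h * (\<mu> * m + r + d)\<^sup>2 + 4 * A * i' * (\<mu> * m + r + d)) * q powi (4 * B * h * m\<^sup>2 + 4 * B * i * m)) =
      q powi (a * (2 * h * m + i)\<^sup>2 + 4 * A * \<mu> * (2 * h * m + i) * r + 4 * h * A * r\<^sup>2)"
      using assms(6) by (simp add: power_int_add[symmetric])
    have "x * y * (u * v * (z * w)) = (x * (u * v)) * (y * (z * w))" for x y u v z w :: complex
      by (simp add: mult_ac)
    then show ?case unfolding x prod.case by (simp only: s p)
  qed auto
  also have "(\<Sum>\<^sub>\<infinity>(n, m). (- 1) powi n * (- 1) powi m * (q powi (4 * A * h * n\<^sup>2 + 4 * A * i' * n) * q powi (4 * B * h * m\<^sup>2 + 4 * B * i * m)))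
     = theta (4 * A * h) (4 * A * i') (- 1) q * theta (4 * B * h) (4 * B * i) (- 1) q"
    by (subst theta_product) (use assms in auto)
  finally show ?thesis .
qed

lemma infsum_residues_snd:
  fixes f :: "int \<times> int \<Rightarrow> complex"
  assumes "f summable_on UNIV" "L > 0"
  shows "infsum f UNIV = (\<Sum>l\<in>{0..<L}. \<Sum>\<^sub>\<infinity>(m, r). f (m, L * r + l))"
proof -
  have sw: "infsum (\<lambda>(x, y). g (y, x)) UNIV = infsum g UNIV" for g :: "int \<times> int \<Rightarrow> complex"
    by (rule infsum_reindex_bij_witness[of _ prod.swap prod.swap]) auto
  have "(\<lambda>(x, y). f (y, x)) summable_on UNIV \<longleftrightarrow> f summable_on UNIV"
    by (rule summable_on_reindex_bij_witness[of _ prod.swap prod.swap]) auto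
  with assms have "(\<lambda>(x, y). f (y, x)) summable_on UNIV" by simp
  from infsum_residues[OF this assms(2)] show ?thesis
    using sw[of f] sw[of "\<lambda>(m, r). f (m, L * r + _)"] by simp
qed

lemma infsum_parity:
  fixes f :: "int \<times> int \<Rightarrow> complex"
  assumes "f summable_on UNIV"
  shows "infsum f UNIV = (\<Sum>\<^sub>\<infinity>(a, j). f (2 * a - j, j)) + (\<Sum>\<^sub>\<infinity>(a, j). f (2 * a + 1 - j, j))"
proof -
  let ?g = "\<lambda>(n, j). f (n - j, j)"
  have "f summable_on UNIV \<longleftrightarrow> ?g summable_on UNIV"
    by (rule summable_on_reindex_bij_witness[of _ "\<lambda>(n, j). (n - j, j)" "\<lambda>(n, j). (n + j, j)"]) auto
  moreover have "infsum f UNIV = infsum ?g UNIV"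
    by (rule infsum_reindex_bij_witness[of _ "\<lambda>(n, j). (n - j, j)" "\<lambda>(n, j). (n + j, j)"]) auto
  ultimately show ?thesis
    using infsum_residues[of ?g 2] assms by (simp add: atLeastLessThan_int_2_3_5)
qed

section \<open>Equivalent forms and differences of their series\<close>

lemma bqseries_shift: "bqseries a b c q = bqseries a (b + 2 * e * a) (a * e\<^sup>2 + b * e + c) q"
  unfolding bqseries_def
proof (rule infsum_reindex_bij_witness[of _ "\<lambda>(n, m). (n + e * m, m)" "\<lambda>(n, m). (n - e * m, m)"], goal_cases)
  case (5 x)
  obtain n m where x: "x = (n, m)" by force
  have "a * (n - e * m)\<^sup>2 + (b + 2 * e * a) * (n - e * m) * m + (a * e\<^sup>2 + b * e + c) * m\<^sup>2 = a * n\<^sup>2 + b * n * m + c * m\<^sup>2"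
    by algebra
  then show ?case by (simp only: x prod.case)
qed auto

lemma bqseries_swap: "bqseries a b c q = bqseries c b a q"
  unfolding bqseries_def
  by (rule infsum_reindex_bij_witness[of _ prod.swap prod.swap]) (auto simp: algebra_simps)

lemma bqseries_neg: "bqseries a (- b) c q = bqseries a b c q"
  unfolding bqseries_def
  by (rule infsum_reindex_bij_witness[of _ "\<lambda>(n, m). (n, - m)" "\<lambda>(n, m). (n, - m)"]) auto

lemma form_summable_complex:
  fixes q :: complex
  assumes "a > 0" "b\<^sup>2 < 4 * a * c" "norm q < 1" "q \<noteq> 0"
  shows "(\<lambda>(n, m). q powi (a * n\<^sup>2 + b * n * m + c * m\<^sup>2)) summable_on UNIV"
proof -
  have "(\<lambda>x. norm (case x of (n, m) \<Rightarrow> q powi (a * n\<^sup>2 + b * n * m + c * m\<^sup>2))) summable_on UNIV"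
    using form_summable[OF assms] by (simp add: case_prod_unfold)
  then show ?thesis by (rule abs_summable_summable)
qed

text \<open>With \<open>F (k, r)\<close> the term of the form (a, b, c), the first series runs over
  even r and the second over k and r of equal parity. Both contain all pairs with k and r even. What
  remains is odd k, with even r counted positively and odd r negatively.\<close>

lemma bqseries_diff:
  assumes "a > 0" "b\<^sup>2 < 4 * a * c" "norm q < 1" "q \<noteq> 0"
  shows "bqseries a (2 * b) (4 * c) q - bqseries (4 * a) (4 * a + 2 * b) (a + b + c) q = alt_bqseries 2 1 a b c q"
proof -
  define F where "F = (\<lambda>(k, r). q powi (a * k\<^sup>2 + b * k * r + c * r\<^sup>2))"
  have pos: "a + b + c > 0"
  proof -
    have "4 * a * (a + b + c) = (2 * a + b)\<^sup>2 + (4 * a * c - b\<^sup>2)" by algebra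
    also have "\<dots> > 0" using assms(2) by (intro add_nonneg_pos) auto
    finally show ?thesis using assms(1) by (simp add: zero_less_mult_iff)
  qed
  have 1: "bqseries a (2 * b) (4 * c) q = (\<Sum>\<^sub>\<infinity>(m, r). F (2 * m, 2 * r)) + (\<Sum>\<^sub>\<infinity>(m, r). F (2 * m + 1, 2 * r))"
  proof -
    have e: "a * n\<^sup>2 + 2 * b * n * m + 4 * c * m\<^sup>2 = a * n\<^sup>2 + b * n * (2 * m) + c * (2 * m)\<^sup>2" for n m :: int
      by algebra
    have "(\<lambda>(n, m). F (n, 2 * m)) summable_on UNIV"
      using form_summable_complex[of a "2 * b" "4 * c" q] assms unfolding F_def prod.case e[symmetric]
      by (simp add: power_mult_distrib)
    from infsum_residues[OF this, of 2] show ?thesis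
      unfolding bqseries_def e by (simp add: atLeastLessThan_int_2_3_5 F_def)
  qed
  have 2: "bqseries (4 * a) (4 * a + 2 * b) (a + b + c) q = (\<Sum>\<^sub>\<infinity>(m, r). F (2 * m, 2 * r)) + (\<Sum>\<^sub>\<infinity>(m, r). F (2 * m + 1, 2 * r + 1))"
  proof -
    have e: "(a + b + c) * n\<^sup>2 + (4 * a + 2 * b) * n * m + 4 * a * m\<^sup>2 = a * (n + 2 * m)\<^sup>2 + b * (n + 2 * m) * n + c * n\<^sup>2" for n m :: int
      by algebra
    have "(4 * a + 2 * b)\<^sup>2 < 4 * (a + b + c) * (4 * a)"
    proof -
      have "4 * (a + b + c) * (4 * a) - (4 * a + 2 * b)\<^sup>2 = 4 * (4 * a * c - b\<^sup>2)" by algebra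
      also have "\<dots> > 0" using assms(2) by simp
      finally show ?thesis by (simp only: diff_gt_0_iff_gt)
    qed
    then have s: "(\<lambda>(n, m). F (n + 2 * m, n)) summable_on UNIV"
      using form_summable_complex[of "a + b + c" "4 * a + 2 * b" "4 * a" q] assms pos unfolding F_def prod.case e[symmetric]
      by simp
    have "bqseries (4 * a) (4 * a + 2 * b) (a + b + c) q = (\<Sum>\<^sub>\<infinity>(n, m). F (n + 2 * m, n))"
      unfolding F_def prod.case e[symmetric] by (subst bqseries_swap) (simp add: bqseries_def)
    also have "\<dots> = (\<Sum>\<^sub>\<infinity>(m, r). F (2 * m + 2 * r, 2 * m)) + (\<Sum>\<^sub>\<infinity>(m, r). F (2 * m + 1 + 2 * r, 2 * m + 1))"
      using infsum_residues[OF s, of 2] by (simp add: atLeastLessThan_int_2_3_5)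
    also have "(\<Sum>\<^sub>\<infinity>(m, r). F (2 * m + 2 * r, 2 * m)) = (\<Sum>\<^sub>\<infinity>(m, r). F (2 * m, 2 * r))"
      by (rule infsum_reindex_bij_witness[of _ "\<lambda>(m, r). (r, m - r)" "\<lambda>(m, r). (m + r, m)"]) auto
    also have "(\<Sum>\<^sub>\<infinity>(m, r). F (2 * m + 1 + 2 * r, 2 * m + 1)) = (\<Sum>\<^sub>\<infinity>(m, r). F (2 * m + 1, 2 * r + 1))"
      by (rule infsum_reindex_bij_witness[of _ "\<lambda>(m, r). (r, m - r)" "\<lambda>(m, r). (m + r, m)"]) (auto simp: algebra_simps)
    finally show ?thesis .
  qed
  have 3: "alt_bqseries 2 1 a b c q = (\<Sum>\<^sub>\<infinity>(m, r). F (2 * m + 1, 2 * r)) - (\<Sum>\<^sub>\<infinity>(m, r). F (2 * m + 1, 2 * r + 1))"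
  proof -
    have s: "(- 1 :: complex) powi (2 * r) = 1" "(- 1 :: complex) powi (2 * r + 1) = - 1" for r :: int
      by (simp_all add: power_int_add power_int_mult)
    have "alt_bqseries 2 1 a b c q = (\<Sum>l\<in>{0..<2}. \<Sum>\<^sub>\<infinity>(m, r). (- 1) powi (2 * r + l) * F (2 * m + 1, 2 * r + l))"
      unfolding alt_bqseries_def F_def
      by (subst infsum_residues_snd[OF alt_bqseries_summable, of _ _ _ _ _ 2]) (use assms in auto)
    then show ?thesis
      by (simp add: atLeastLessThan_int_2_3_5 s case_prod_unfold infsum_uminus)
  qed
  show ?thesis unfolding 1 2 3 by simp
qed

text \<open>In the two applications the exponents are the norm form of the hexagonal lattice, up to scaling, and the
  index maps come from multiplication by sixth roots of unity; they match half of the left-hand side with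
  the right-hand side and cancel the other half.\<close>

lemma hexagonal_sum:
  fixes F\<^sub>1 F\<^sub>2 K :: "int \<times> int \<Rightarrow> complex"
  assumes "F\<^sub>1 summable_on UNIV" "F\<^sub>2 summable_on UNIV" "K summable_on UNIV"
    and 1: "\<And>a j. F\<^sub>1 (2 * a - j, j) = K (a, a - 2 * j)"
    and 2: "\<And>a j. F\<^sub>2 (2 * a + 1 - j, j) = K (- a - 1, a - 2 * j)"
    and 3: "\<And>a j. F\<^sub>1 (2 * a + 1 - j, j) = - F\<^sub>2 (- a - j - 1, j - a - 1)"
  shows "infsum F\<^sub>1 UNIV + infsum F\<^sub>2 UNIV = infsum K UNIV"
proof -
  have "(\<Sum>\<^sub>\<infinity>(a, j). F\<^sub>1 (2 * a + 1 - j, j)) = (\<Sum>\<^sub>\<infinity>(a, j). - F\<^sub>2 (2 * a - j, j))"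
  proof (rule infsum_reindex_bij_witness[of _ "\<lambda>(a, j). (- a - 1, j - a)" "\<lambda>(a, j). (- a - 1, j - a - 1)"], goal_cases)
    case (5 x)
    obtain a j where x: "x = (a, j)" by force
    have "2 * (- a - 1) - (j - a - 1) = - a - j - 1" by simp
    then show ?case unfolding x prod.case 3 by (simp only:)
  qed auto
  then have c: "(\<Sum>\<^sub>\<infinity>(a, j). F\<^sub>1 (2 * a + 1 - j, j)) = - (\<Sum>\<^sub>\<infinity>(a, j). F\<^sub>2 (2 * a - j, j))"
    by (simp add: case_prod_unfold infsum_uminus)
  let ?L = "\<lambda>(b, a). K (a, b)"
  have "?L summable_on UNIV \<longleftrightarrow> K summable_on UNIV"
    by (rule summable_on_reindex_bij_witness[of _ prod.swap prod.swap]) auto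
  with assms(3) have L: "?L summable_on UNIV" by simp
  have "infsum K UNIV = infsum ?L UNIV"
    by (rule infsum_reindex_bij_witness[of _ prod.swap prod.swap]) auto
  also have "\<dots> = (\<Sum>\<^sub>\<infinity>(a, j). K (j, 2 * a - j)) + (\<Sum>\<^sub>\<infinity>(a, j). K (j, 2 * a + 1 - j))"
    using infsum_parity[OF L] by simp
  also have "(\<Sum>\<^sub>\<infinity>(a, j). K (j, 2 * a - j)) = (\<Sum>\<^sub>\<infinity>(a, j). K (a, a - 2 * j))"
    by (rule infsum_reindex_bij_witness[of _ "\<lambda>(a, j). (a - j, a)" "\<lambda>(a, j). (j, j - a)"]) (auto simp: algebra_simps)
  also have "(\<Sum>\<^sub>\<infinity>(a, j). K (j, 2 * a + 1 - j)) = (\<Sum>\<^sub>\<infinity>(a, j). K (- a - 1, a - 2 * j))"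
    by (rule infsum_reindex_bij_witness[of _ "\<lambda>(a, j). (- j - 1, - a - 1)" "\<lambda>(a, j). (- j - 1, - a - 1)"]) (auto simp: algebra_simps)
  finally show ?thesis
    unfolding infsum_parity[OF assms(1)] infsum_parity[OF assms(2)] 1 2 c by simp
qed

lemma powi_term_cong:
  assumes "(x :: complex) = y" "a = b"
  shows "x * q powi a = y * q powi b"
  using assms by simp

lemma powi_term_cong_neg:
  assumes "(x :: complex) = - y" "a = b"
  shows "x * q powi a = - (y * q powi b)"
  using assms by simp

lemma minus_one_product_cong:
  assumes "even (a + b - (c + d))"
  shows "(- 1 :: complex) powi a * (- 1) powi b = (- 1) powi c * (- 1) powi d"
  using minus_one_powi_cong[OF assms] by (simp add: power_int_add)

lemma minus_one_product_cong_neg: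
  assumes "odd (a + b - (c + d))"
  shows "(- 1 :: complex) powi a * (- 1) powi b = - ((- 1) powi c * (- 1) powi d)"
proof -
  have "(- 1 :: complex) powi (a + b) = (- 1) powi (1 + (c + d))"
    by (rule minus_one_powi_cong) (use assms in presburger)
  then show ?thesis by (simp add: power_int_add)
qed

section \<open>Identities between products of two theta series\<close>

context
  fixes t :: complex
  assumes t: "norm t < 1" "t \<noteq> 0"
begin

lemma theta_product_self:
  assumes "norm s = 1" "norm s' = 1" "a > 0" "a' > 0"
  shows "theta a b s t * theta a' b' s' t =
      (\<Sum>\<^sub>\<infinity>(n, m). (s powi n * s' powi m) * t powi (a * n\<^sup>2 + b * n + (a' * m\<^sup>2 + b' * m)))"
    and "(\<lambda>(n, m). (s powi n * s' powi m) * t powi (a * n\<^sup>2 + b * n + (a' * m\<^sup>2 + b' * m))) summable_on UNIV"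
  using theta_product[of s s' t t a a' b b'] theta_product_summable[of s s' t t a a' b b'] assms t
  by (auto simp: power_int_add)

text \<open>With x = t^2 and the Rogers-Ramanujan identities, the bracket is E(x^5) G(x) / H(x). In
  all three double sums, 60 times the exponent is u^2 + 3v^2 - 28, with (u, v) = (30m + 1, 10n + 3),
  (30m + 11, 10n + 3) and (30n + 5, 10m + 1); the factor t^2 gives the second sum the same
  constant.\<close>

lemma hexagonal_theta_1:
  "theta 5 3 (- 1) t * (theta 15 1 (- 1) t + t\<^sup>2 * theta 15 11 (- 1) t) = theta 15 5 (- 1) t * theta 5 1 (- 1) t"
proof -
  let ?F1 = "\<lambda>(n, m). ((- 1) powi n * (- 1) powi m) * t powi (5 * n\<^sup>2 + 3 * n + (15 * m\<^sup>2 + 1 * m))"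
  let ?F2 = "\<lambda>(n, m). ((- 1) powi n * (- 1) powi m) * t powi (2 + (5 * n\<^sup>2 + 3 * n + (15 * m\<^sup>2 + 11 * m)))"
  let ?K = "\<lambda>(n, m). ((- 1) powi n * (- 1) powi m) * t powi (15 * n\<^sup>2 + 5 * n + (5 * m\<^sup>2 + 1 * m))"
  have F2: "?F2 = (\<lambda>x. t\<^sup>2 * (case x of (n, m) \<Rightarrow> ((- 1) powi n * (- 1) powi m) * t powi (5 * n\<^sup>2 + 3 * n + (15 * m\<^sup>2 + 11 * m))))"
    using t by (auto simp: power_int_add)
  have "infsum ?F1 UNIV + infsum ?F2 UNIV = infsum ?K UNIV"
  proof (rule hexagonal_sum, goal_cases)
    case 2
    show ?case unfolding F2 by (intro summable_on_cmult_right theta_product_self) auto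
  next
    case (4 a j)
    show ?case unfolding prod.case
      by (intro powi_term_cong minus_one_product_cong) (auto, algebra)
  next
    case (5 a j)
    show ?case unfolding prod.case
      by (intro powi_term_cong minus_one_product_cong) (auto, algebra)
  next
    case (6 a j)
    show ?case unfolding prod.case
      by (intro powi_term_cong_neg minus_one_product_cong_neg) (auto, algebra)
  qed (intro theta_product_self; simp)+
  moreover have "infsum ?F2 UNIV = t\<^sup>2 * (theta 5 3 (- 1) t * theta 15 11 (- 1) t)"
    unfolding F2 infsum_cmult_right' by (subst theta_product_self) auto
  moreover have "theta 5 3 (- 1) t * theta 15 1 (- 1) t = infsum ?F1 UNIV"
      "theta 15 5 (- 1) t * theta 5 1 (- 1) t = infsum ?K UNIV"
    by (rule theta_product_self; simp)+
  moreover have "x * (y + u * z) = x * y + u * (x * z)" for x y z u :: complex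
    by (simp add: algebra_simps)
  ultimately show ?thesis by (simp only:)
qed

text \<open>The companion for E(x^5) H(x) / G(x), with x = t^2. Here 60 times the exponent is u^2 +
  3v^2 - 52, and t^4 adjusts the constant of the second sum.\<close>

lemma hexagonal_theta_2:
  "theta 5 1 (- 1) t * (theta 15 7 (- 1) t + t ^ 4 * theta 15 17 (- 1) t) = theta 15 5 (- 1) t * theta 5 3 (- 1) t"
proof -
  let ?F1 = "\<lambda>(n, m). ((- 1) powi n * (- 1) powi m) * t powi (5 * n\<^sup>2 + 1 * n + (15 * m\<^sup>2 + 7 * m))"
  let ?F2 = "\<lambda>(n, m). ((- 1) powi n * (- 1) powi m) * t powi (4 + (5 * n\<^sup>2 + 1 * n + (15 * m\<^sup>2 + 17 * m)))"
  \<comment> \<open>The linear coefficient is -3 and not 3, so that the index maps of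
    \<open>hexagonal_sum\<close> fit here as well; \<open>theta_neg\<close> restores the sign at the
    end.\<close>
  let ?K = "\<lambda>(n, m). ((- 1) powi n * (- 1) powi m) * t powi (15 * n\<^sup>2 + 5 * n + (5 * m\<^sup>2 + (- 3) * m))"
  have F2: "?F2 = (\<lambda>x. t ^ 4 * (case x of (n, m) \<Rightarrow> ((- 1) powi n * (- 1) powi m) * t powi (5 * n\<^sup>2 + 1 * n + (15 * m\<^sup>2 + 17 * m))))"
    using t by (auto simp: power_int_add)
  have "infsum ?F1 UNIV + infsum ?F2 UNIV = infsum ?K UNIV"
  proof (rule hexagonal_sum, goal_cases)
    case 2
    show ?case unfolding F2 by (intro summable_on_cmult_right theta_product_self) auto
  next
    case (4 a j)
    show ?case unfolding prod.case
      by (intro powi_term_cong minus_one_product_cong) (auto, algebra)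
  next
    case (5 a j)
    show ?case unfolding prod.case
      by (intro powi_term_cong minus_one_product_cong) (auto, algebra)
  next
    case (6 a j)
    show ?case unfolding prod.case
      by (intro powi_term_cong_neg minus_one_product_cong_neg) (auto, algebra)
  qed (intro theta_product_self; simp)+
  moreover have "infsum ?F2 UNIV = t ^ 4 * (theta 5 1 (- 1) t * theta 15 17 (- 1) t)"
    unfolding F2 infsum_cmult_right' by (subst theta_product_self) auto
  moreover have "theta 5 (- 3) (- 1) t = theta 5 3 (- 1) t"
    by (simp add: theta_neg)
  moreover have "theta 5 1 (- 1) t * theta 15 7 (- 1) t = infsum ?F1 UNIV"
      "theta 15 5 (- 1) t * theta 5 (- 3) (- 1) t = infsum ?K UNIV"
    by (rule theta_product_self; simp)+
  moreover have "x * (y + u * z) = x * y + u * (x * z)" for x y z u :: complex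
    by (simp add: algebra_simps)
  ultimately show ?thesis by (simp only:)
qed

text \<open>With x = t^2 this is psi(x^3) E(x) = f(-x, -x^5) E(x^2), doubled. The map n -> -1 - n
  fixes 3n^2 + 3n and exchanges the classes of even and odd n + m, whence the 2; on the even class n
  = a + b and m = a - b separate the variables.\<close>

lemma theta_parity_1:
  "theta 3 3 1 t * theta 3 1 (- 1) t = 2 * (theta 6 4 (- 1) t * theta 6 2 (- 1) t)"
proof -
  let ?F = "\<lambda>(n, m). (1 powi n * (- 1) powi m) * t powi (3 * n\<^sup>2 + 3 * n + (3 * m\<^sup>2 + 1 * m))"
  let ?G = "\<lambda>(n, m). ((- 1) powi n * (- 1) powi m) * t powi (6 * n\<^sup>2 + 4 * n + (6 * m\<^sup>2 + 2 * m))"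
  have F: "?F summable_on UNIV" by (rule theta_product_self) auto
  have odd: "(\<Sum>\<^sub>\<infinity>(a, j). ?F (2 * a + 1 - j, j)) = (\<Sum>\<^sub>\<infinity>(a, j). ?F (2 * a - j, j))"
  proof (rule infsum_reindex_bij_witness[of _ "\<lambda>(a, j). (j - a - 1, j)" "\<lambda>(a, j). (j - a - 1, j)"], goal_cases)
    case (5 x)
    obtain a j where x: "x = (a, j)" by force
    show ?case unfolding x prod.case
      by (rule powi_term_cong) (simp, algebra)
  qed auto
  have even: "(\<Sum>\<^sub>\<infinity>(a, j). ?F (2 * a - j, j)) = infsum ?G UNIV"
  proof (rule infsum_reindex_bij_witness[of _ "\<lambda>(a, b). (a, a - b)" "\<lambda>(a, j). (a, a - j)"], goal_cases)
    case (5 x)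
    obtain a j where x: "x = (a, j)" by force
    have "(- 1 :: complex) powi a * (- 1) powi (a - j) = 1 powi (2 * a - j) * (- 1) powi j"
      using minus_one_product_cong[of a "a - j" 0 j] by simp
    then show ?case unfolding x prod.case
      by (rule powi_term_cong) algebra
  qed auto
  have "theta 3 3 1 t * theta 3 1 (- 1) t = 2 * infsum ?G UNIV"
    using infsum_parity[OF F] unfolding odd even by (simp add: theta_product_self)
  then show ?thesis by (simp add: theta_product_self)
qed

text \<open>With x = t^2 this is phi(-x^3) E(x^2) = f(x, x^2) E(x). Both indices carry the exponent
  3n^2 + n, so exchanging them preserves the exponent; for odd n + m it reverses the sign (-1)^m,
  and that class sums to 0.\<close>

lemma theta_parity_2:
  "theta 6 0 (- 1) t * theta 6 2 (- 1) t = theta 3 1 1 t * theta 3 1 (- 1) t"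
proof -
  let ?F = "\<lambda>(n, m). (1 powi n * (- 1) powi m) * t powi (3 * n\<^sup>2 + 1 * n + (3 * m\<^sup>2 + 1 * m))"
  let ?G = "\<lambda>(n, m). ((- 1) powi n * (- 1) powi m) * t powi (6 * n\<^sup>2 + 0 * n + (6 * m\<^sup>2 + 2 * m))"
  have F: "?F summable_on UNIV" by (rule theta_product_self) auto
  have "(\<Sum>\<^sub>\<infinity>(a, j). ?F (2 * a + 1 - j, j)) = (\<Sum>\<^sub>\<infinity>(a, j). - ?F (2 * a + 1 - j, j))"
  proof (rule infsum_reindex_bij_witness[of _ "\<lambda>(a, j). (a, 2 * a + 1 - j)" "\<lambda>(a, j). (a, 2 * a + 1 - j)"], goal_cases)
    case (5 x)
    obtain a j where x: "x = (a, j)" by force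
    have "(- 1 :: complex) powi 0 * (- 1) powi (2 * a + 1 - j) = - ((- 1) powi 0 * (- 1) powi j)"
      by (rule minus_one_product_cong_neg) auto
    then show ?case unfolding x prod.case
      by (simp add: algebra_simps)
  qed auto
  then have odd: "(\<Sum>\<^sub>\<infinity>(a, j). ?F (2 * a + 1 - j, j)) = 0"
    by (simp add: case_prod_unfold infsum_uminus)
  have even: "(\<Sum>\<^sub>\<infinity>(a, j). ?F (2 * a - j, j)) = infsum ?G UNIV"
  proof (rule infsum_reindex_bij_witness[of _ "\<lambda>(n, m). (m, m - n)" "\<lambda>(a, j). (a - j, a)"], goal_cases)
    case (5 x)
    obtain a j where x: "x = (a, j)" by force
    have "(- 1 :: complex) powi (a - j) * (- 1) powi a = 1 powi (2 * a - j) * (- 1) powi j"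
      using minus_one_product_cong[of "a - j" a 0 j] by simp
    then show ?case unfolding x prod.case
      by (rule powi_term_cong) algebra
  qed auto
  have "theta 3 1 1 t * theta 3 1 (- 1) t = infsum ?G UNIV"
    using infsum_parity[OF F] unfolding odd even by (simp add: theta_product_self)
  then show ?thesis by (simp add: theta_product_self)
qed

text \<open>Three times the form is A k^2 + 8B (k + 3r)^2, and k and k + 3r agree modulo 3. The
  second variable is shifted by the even number 2m, so the sign (-1)^r falls on the second theta
  series alone. For k divisible by 3 the shift is the odd number 2m + 1, which causes the minus
  sign.\<close>

lemma alt_bqseries_mod_3:
  assumes "3 * a = A + 8 * B" "A > 0" "B > 0"
  shows "alt_bqseries 6 1 a (16 * B) (24 * B) t = t powi a * (theta (12 * A) (4 * A) 1 t * theta (24 * B) (16 * B) (- 1) t)"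
    and "alt_bqseries 6 3 a (16 * B) (24 * B) t = - (t powi (3 * A) * (theta (12 * A) (12 * A) 1 t * theta (24 * B) 0 (- 1) t))"
proof -
  have "alt_bqseries 6 1 a (16 * B) (24 * B) t = (\<Sum>\<^sub>\<infinity>(n, m). t powi a * ((1 powi n * (- 1) powi m) * t powi (12 * A * n\<^sup>2 + 4 * A * n + (24 * B * m\<^sup>2 + 16 * B * m))))"
    unfolding alt_bqseries_def
  proof (rule infsum_reindex_bij_witness[of _ "\<lambda>(m, r). (m, r - 2 * m)" "\<lambda>(m, r). (m, 2 * m + r)"], goal_cases)
    case (5 x)
    obtain m r where x: "x = (m, r)" by force
    have "(1 powi m * (- 1 :: complex) powi (2 * m + r)) = (- 1) powi r"
      by (simp, rule minus_one_powi_cong) simp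
    moreover have "3 * (a + (12 * A * m\<^sup>2 + 4 * A * m + (24 * B * (2 * m + r)\<^sup>2 + 16 * B * (2 * m + r)))) = 3 * (a * (6 * m + 1)\<^sup>2 + 16 * B * (6 * m + 1) * r + 24 * B * r\<^sup>2)"
      using assms(1) by algebra
    then have "a + (12 * A * m\<^sup>2 + 4 * A * m + (24 * B * (2 * m + r)\<^sup>2 + 16 * B * (2 * m + r))) =
      a * (6 * m + 1)\<^sup>2 + 16 * B * (6 * m + 1) * r + 24 * B * r\<^sup>2"
      by (simp only: mult_cancel_left) simp
    ultimately show ?case unfolding x prod.case
      using t by (simp add: power_int_add[symmetric] mult.left_commute[of "t powi a"])
  qed auto
  then show "alt_bqseries 6 1 a (16 * B) (24 * B) t = t powi a * (theta (12 * A) (4 * A) 1 t * theta (24 * B) (16 * B) (- 1) t)"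
    using assms by (simp add: theta_product_self infsum_cmult_right'[symmetric] case_prod_unfold)
  have "alt_bqseries 6 3 a (16 * B) (24 * B) t = (\<Sum>\<^sub>\<infinity>(n, m). (- (t powi (3 * A))) * ((1 powi n * (- 1) powi m) * t powi (12 * A * n\<^sup>2 + 12 * A * n + (24 * B * m\<^sup>2 + 0 * m))))"
    unfolding alt_bqseries_def
  proof (rule infsum_reindex_bij_witness[of _ "\<lambda>(m, r). (m, r - 2 * m - 1)" "\<lambda>(m, r). (m, 2 * m + 1 + r)"], goal_cases)
    case (5 x)
    obtain m r where x: "x = (m, r)" by force
    have "(- 1 :: complex) powi 0 * (- 1) powi (2 * m + 1 + r) = - ((- 1) powi 0 * (- 1) powi r)"
      by (rule minus_one_product_cong_neg) simp
    moreover have "3 * (3 * A + (12 * A * m\<^sup>2 + 12 * A * m + (24 * B * (2 * m + 1 + r)\<^sup>2 + 0 * (2 * m + 1 + r)))) = 3 * (a * (6 * m + 3)\<^sup>2 + 16 * B * (6 * m + 3) * r + 24 * B * r\<^sup>2)"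
      using assms(1) by algebra
    then have "3 * A + (12 * A * m\<^sup>2 + 12 * A * m + (24 * B * (2 * m + 1 + r)\<^sup>2 + 0 * (2 * m + 1 + r))) =
      a * (6 * m + 3)\<^sup>2 + 16 * B * (6 * m + 3) * r + 24 * B * r\<^sup>2"
      by (simp only: mult_cancel_left) simp
    ultimately show ?case unfolding x prod.case
      using t by (simp add: power_int_add[symmetric] mult.left_commute[of "t powi (3 * A)"])
  qed auto
  then show "alt_bqseries 6 3 a (16 * B) (24 * B) t = - (t powi (3 * A) * (theta (12 * A) (12 * A) 1 t * theta (24 * B) 0 (- 1) t))"
    using assms by (simp add: theta_product_self infsum_cmult_right'[symmetric] infsum_uminus[symmetric] case_prod_unfold)
qed

lemma alt_bqseries_diagonal:
  assumes "A > 0" "B > 0"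
  shows "alt_bqseries 2 1 A 0 B t = t powi A * (theta (4 * A) (4 * A) 1 t * theta B 0 (- 1) t)"
proof -
  have e: "A * (2 * m + 1)\<^sup>2 + 0 * (2 * m + 1) * r + B * r\<^sup>2 = A + (4 * A * m\<^sup>2 + 4 * A * m + (B * r\<^sup>2 + 0 * r))" for m r :: int
    by algebra
  have "alt_bqseries 2 1 A 0 B t = (\<Sum>\<^sub>\<infinity>(n, m). t powi A * ((1 powi n * (- 1) powi m) * t powi (4 * A * n\<^sup>2 + 4 * A * n + (B * m\<^sup>2 + 0 * m))))"
    unfolding alt_bqseries_def e using t by (simp add: power_int_add mult_ac)
  then show ?thesis
    using assms by (simp add: theta_product_self infsum_cmult_right'[symmetric] case_prod_unfold)
qed

end

lemma alt_bqseries_6_3: "alt_bqseries 6 3 a b c q = alt_bqseries 2 1 (9 * a) (3 * b) c q"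
proof -
  have "9 * a * (2 * m + 1)\<^sup>2 + 3 * b * (2 * m + 1) * r + c * r\<^sup>2 = a * (6 * m + 3)\<^sup>2 + b * (6 * m + 3) * r + c * r\<^sup>2" for m r :: int
    by algebra
  then show ?thesis unfolding alt_bqseries_def by simp
qed

section \<open>Rogers--Ramanujan identities and the triple product\<close>

text \<open>Tannery's theorem: the majorant makes the finite partial sums converge uniformly in n,
  so the two limits may be exchanged.\<close>

lemma tendsto_infsum_dominated:
  fixes f :: "'a \<Rightarrow> nat \<Rightarrow> complex"
  assumes "M summable_on X" "\<And>x n. x \<in> X \<Longrightarrow> norm (f x n) \<le> M x" "\<And>x. x \<in> X \<Longrightarrow> f x \<longlonglongrightarrow> g x"
  shows "(\<lambda>n. \<Sum>\<^sub>\<infinity>x\<in>X. f x n) \<longlonglongrightarrow> (\<Sum>\<^sub>\<infinity>x\<in>X. g x)"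
proof (rule swap_uniform_limit'[where F = "finite_subsets_at_top X" and S = UNIV])
  have "norm (g x) \<le> M x" if "x \<in> X" for x
    using assms(2,3)[OF that] by (intro tendsto_upperbound[OF tendsto_norm]) auto
  then have "(\<lambda>x. norm (g x)) summable_on X"
    by (rule Infinite_Sum.abs_summable_on_comparison_test'[OF assms(1)])
  then show "(sum g \<longlongrightarrow> infsum g X) (finite_subsets_at_top X)"
    by (rule infsum_tendsto[OF abs_summable_summable])
  show "\<forall>\<^sub>F Y in finite_subsets_at_top X. (\<lambda>n. \<Sum>x\<in>Y. f x n) \<longlonglongrightarrow> sum g Y"
    by (rule eventually_finite_subsets_at_top_weakI) (auto intro!: tendsto_sum assms(3))
  show "uniform_limit UNIV (\<lambda>Y n. \<Sum>x\<in>Y. f x n) (\<lambda>n. \<Sum>\<^sub>\<infinity>x\<in>X. f x n) (finite_subsets_at_top X)"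
    by (rule Weierstrass_m_test_general[OF _ assms(1)]) (use assms(2) in auto)
qed auto

lemma qpoch_tendsto:
  assumes "norm q < 1"
  shows "qpoch a q \<longlonglongrightarrow> qpoch_inf a q"
proof -
  have "summable (\<lambda>k. norm (a * q ^ k))"
    using assms by (simp add: norm_mult norm_power summable_mult summable_geometric)
  then have "abs_convergent_prod (\<lambda>k. 1 - a * q ^ k)"
    by (intro summable_imp_abs_convergent_prod) (simp add: norm_minus_commute)
  then have "(\<lambda>n. \<Prod>k\<le>n. 1 - a * q ^ k) \<longlonglongrightarrow> qpoch_inf a q"
    unfolding qpoch_inf_def by (intro convergent_prod_LIMSEQ abs_convergent_prod_imp_convergent_prod)
  then have "(\<lambda>n. qpoch a q (Suc n)) \<longlonglongrightarrow> qpoch_inf a q"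
    by (simp add: qpoch_def lessThan_Suc_atMost)
  then show ?thesis by (rule LIMSEQ_imp_Suc)
qed

lemma one_minus_power_nonzero:
  assumes "norm (q :: complex) < 1"
  shows "1 - q * q ^ k \<noteq> 0"
proof
  assume "1 - q * q ^ k = 0"
  then have "q ^ Suc k = 1" by (simp only: right_minus_eq power_Suc)
  then have "norm (q ^ Suc k) = 1" by (simp only: norm_one)
  moreover have "norm (q ^ Suc k) < 1" using power_decreasing[of 1 "Suc k" "norm q"] assms by (simp only: norm_power) auto
  ultimately show False by simp
qed

lemma qpoch_nonzero: "norm q < 1 \<Longrightarrow> qpoch q q n \<noteq> 0"
  using one_minus_power_nonzero[of q] by (simp add: qpoch_def)

lemma eulerE_nonzero:
  assumes "norm q < 1"
  shows "eulerE q \<noteq> 0"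
proof -
  have "summable (\<lambda>k. norm (q * q ^ k))"
    using assms by (simp add: norm_mult norm_power summable_mult summable_geometric)
  then have "abs_convergent_prod (\<lambda>k. 1 - q * q ^ k)"
    by (intro summable_imp_abs_convergent_prod) (simp add: norm_minus_commute)
  then show ?thesis unfolding eulerE_def qpoch_inf_def
    by (intro prodinf_nonzero abs_convergent_prod_imp_convergent_prod one_minus_power_nonzero assms)
qed

lemma qpoch_Suc: "qpoch a q (Suc n) = qpoch a q n * (1 - a * q ^ n)"
  by (simp add: qpoch_def)

lemma qpoch_0: "qpoch a q 0 = 1"
  by (simp add: qpoch_def)

lemma nat_int_Suc: "nat (1 + int n) = Suc n"
  by linarith

section \<open>Gaussian binomial coefficients\<close>

text \<open>The lower index is an integer and the value outside the triangle is 0, so sums over all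
  integers can be shifted and reflected without boundary terms.\<close>

definition qbinom :: "complex \<Rightarrow> nat \<Rightarrow> int \<Rightarrow> complex" where
  "qbinom q n k = (if 0 \<le> k \<and> k \<le> int n then
     qpoch q q n / (qpoch q q (nat k) * qpoch q q (nat (int n - k))) else 0)"

lemma qbinom_sym: "qbinom q n (int n - k) = qbinom q n k"
  by (simp add: qbinom_def mult.commute)

lemma qbinom_absorb:
  assumes "norm q < 1" "q \<noteq> 0"
  shows "(1 - q powi (int (Suc n) - k)) * qbinom q (Suc n) k = (1 - q ^ Suc n) * qbinom q n k"
proof (cases "0 \<le> k \<and> k \<le> int n")
  case True
  then have s: "nat (int (Suc n) - k) = Suc (nat (int n - k))" by linarith
  have "int (Suc n) - k = int (Suc (nat (int n - k)))" using True by linarith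
  then have "q powi (int (Suc n) - k) = q powi int (Suc (nat (int n - k)))" by (rule arg_cong)
  also have "\<dots> = q * q ^ nat (int n - k)" by (simp only: power_int_of_nat power_Suc)
  finally have p: "q powi (int (Suc n) - k) = q * q ^ nat (int n - k)" .
  show ?thesis
    unfolding p using True qpoch_nonzero[OF assms(1)] one_minus_power_nonzero[OF assms(1)]
    by (simp add: qbinom_def s qpoch_Suc divide_simps del: of_nat_Suc)
next
  case False
  \<comment> \<open>At k = n + 1 the factor 1 - q^0 on the left vanishes; in the other two cases
    both coefficients are 0.\<close>
  then consider "k < 0" | "k = int (Suc n)" | "k > int (Suc n)" by linarith
  then show ?thesis by cases (auto simp: qbinom_def)
qed

lemma qbinom_Suc:
  assumes "norm q < 1" "q \<noteq> 0"
  shows "qbinom q (Suc n) k = qbinom q n k + q powi (int (Suc n) - k) * qbinom q n (k - 1)"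
proof (cases "1 \<le> k \<and> k \<le> int n")
  case True
  define i j where "i = nat (k - 1)" and "j = nat (int n - k)"
  have k: "k = int (Suc i)" and n: "n = Suc (i + j)" using True by (auto simp: i_def j_def)
  have nz: "qpoch q q m \<noteq> 0" "1 - q * q ^ m \<noteq> 0" for m
    using qpoch_nonzero[OF assms(1)] one_minus_power_nonzero[OF assms(1)] by auto
  have p: "q powi (int (Suc n) - k) = q ^ Suc j" unfolding k n
    by (simp flip: power_int_of_nat)
  have b1: "qbinom q (Suc n) k = qpoch q q (Suc n) / (qpoch q q (Suc i) * qpoch q q (Suc j))"
    unfolding qbinom_def k n by (simp add: nat_add_distrib)
  have b2: "qbinom q n k = qpoch q q n / (qpoch q q (Suc i) * qpoch q q j)"
    unfolding qbinom_def k n by (simp add: nat_add_distrib)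
  have b3: "qbinom q n (k - 1) = qpoch q q n / (qpoch q q i * qpoch q q (Suc j))"
    unfolding qbinom_def k n by (simp add: nat_add_distrib)
  have "qpoch q q n * (1 - q * q ^ n) / ((qpoch q q i * (1 - q * q ^ i)) * (qpoch q q j * (1 - q * q ^ j))) =
    qpoch q q n / ((qpoch q q i * (1 - q * q ^ i)) * qpoch q q j) + q ^ Suc j * (qpoch q q n / (qpoch q q i * (qpoch q q j * (1 - q * q ^ j))))"
    using nz by (simp add: divide_simps) (simp add: n power_add algebra_simps)
  then show ?thesis unfolding b1 b2 b3 p by (simp only: qpoch_Suc)
next
  case False
  then consider "k < 0" | "k = 0" | "k = int (Suc n)" | "k > int (Suc n)" by linarith
  then show ?thesis
    by cases (use qpoch_nonzero[OF assms(1)] in \<open>auto simp: qbinom_def qpoch_0 nat_int_Suc\<close>)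
qed

lemma qbinom_Suc':
  assumes "norm q < 1" "q \<noteq> 0"
  shows "qbinom q (Suc n) k = qbinom q n (k - 1) + q powi k * qbinom q n k"
proof -
  have "qbinom q (Suc n) k = qbinom q (Suc n) (int (Suc n) - k)" by (simp only: qbinom_sym)
  also have "\<dots> = qbinom q n (int n - (k - 1)) + q powi k * qbinom q n (int n - k)"
    by (subst qbinom_Suc[OF assms]) (simp add: algebra_simps)
  finally show ?thesis by (simp only: qbinom_sym)
qed

lemma qbinom_summable:
  assumes "inj \<alpha>"
  shows "(\<lambda>j :: int. f j * qbinom q n (\<alpha> j)) summable_on UNIV"
proof (rule finite_nonzero_values_imp_summable_on)
  have "{j \<in> UNIV. f j * qbinom q n (\<alpha> j) \<noteq> 0} \<subseteq> \<alpha> -` {0..int n}"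
    by (auto simp: qbinom_def split: if_splits)
  then show "finite {j \<in> UNIV. f j * qbinom q n (\<alpha> j) \<noteq> 0}"
    by (rule finite_subset) (intro finite_vimageI assms finite_atLeastAtMost_int)
qed

lemma tendsto_qpoch_shift:
  assumes "norm q < 1" "filterlim \<phi> at_top sequentially"
  shows "(\<lambda>n. qpoch q q (\<phi> n)) \<longlonglongrightarrow> eulerE q"
  using filterlim_compose[OF qpoch_tendsto[OF assms(1), of q] assms(2)] by (simp add: eulerE_def)

lemma filterlim_nat_int_shift: "filterlim (\<lambda>n. nat (int n + c)) at_top sequentially"
  unfolding filterlim_at_top eventually_sequentially
proof
  fix Z :: nat
  show "\<exists>N. \<forall>n\<ge>N. Z \<le> nat (int n + c)" by (rule exI[of _ "Z + nat \<bar>c\<bar>"]) auto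
qed

lemma qbinom_tendsto_central:
  assumes "norm q < 1"
  shows "(\<lambda>n. qbinom q (2 * n + d) (int n + c)) \<longlonglongrightarrow> 1 / eulerE q"
proof -
  have "filterlim (\<lambda>n. 2 * n + d) at_top sequentially"
    by (rule filterlim_at_top_mono[OF filterlim_ident]) auto
  then have "(\<lambda>n. qpoch q q (2 * n + d) / (qpoch q q (nat (int n + c)) * qpoch q q (nat (int n + (int d - c))))) \<longlonglongrightarrow> eulerE q / (eulerE q * eulerE q)"
    using eulerE_nonzero[OF assms] by (intro tendsto_intros tendsto_qpoch_shift[OF assms] filterlim_nat_int_shift) auto
  also have "eulerE q / (eulerE q * eulerE q) = 1 / eulerE q"
    using eulerE_nonzero[OF assms] by simp
  finally show ?thesis
  proof (rule Lim_transform_eventually)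
    show "\<forall>\<^sub>F n in sequentially. qpoch q q (2 * n + d) / (qpoch q q (nat (int n + c)) * qpoch q q (nat (int n + (int d - c)))) = qbinom q (2 * n + d) (int n + c)"
      using eventually_ge_at_top[of "nat \<bar>c\<bar> + d"]
    proof eventually_elim
      case (elim n)
      then have "0 \<le> int n + c" "int n + c \<le> int (2 * n + d)" "int (2 * n + d) - (int n + c) = int n + (int d - c)" by auto
      then show ?case by (simp only: qbinom_def) simp
    qed
  qed
qed

lemma qbinom_tendsto_fixed:
  assumes "norm q < 1"
  shows "(\<lambda>n. qbinom q n (int j)) \<longlonglongrightarrow> 1 / qpoch q q j"
proof -
  have "(\<lambda>n. qpoch q q n / (qpoch q q j * qpoch q q (nat (int n + (- int j))))) \<longlonglongrightarrow> eulerE q / (qpoch q q j * eulerE q)"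
    using eulerE_nonzero[OF assms] qpoch_nonzero[OF assms]
    by (intro tendsto_intros tendsto_qpoch_shift[OF assms] filterlim_nat_int_shift) (auto simp: filterlim_ident)
  also have "eulerE q / (qpoch q q j * eulerE q) = 1 / qpoch q q j"
    using eulerE_nonzero[OF assms] by simp
  finally show ?thesis
  proof (rule Lim_transform_eventually)
    show "\<forall>\<^sub>F n in sequentially. qpoch q q n / (qpoch q q j * qpoch q q (nat (int n + (- int j)))) = qbinom q n (int j)"
      using eventually_ge_at_top[of j] by eventually_elim (simp add: qbinom_def)
  qed
qed

text \<open>Supplies the majorant for termwise limits. Both (q; q)_n and its inverse are bounded,
  since (q; q)_n converges to E(q), which is not 0.\<close>

lemma qbinom_bounded:
  assumes "norm q < 1"
  obtains C where "C \<ge> 0" "\<And>n k. norm (qbinom q n k) \<le> C"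
proof -
  have l: "qpoch q q \<longlonglongrightarrow> eulerE q" using qpoch_tendsto[OF assms, of q] by (simp add: eulerE_def)
  then have "Bseq (qpoch q q)" by (intro convergent_imp_Bseq) (auto simp: convergent_def)
  then obtain C1 where C1: "C1 > 0" "\<And>n. norm (qpoch q q n) \<le> C1" by (auto simp: Bseq_def)
  have "(\<lambda>n. inverse (qpoch q q n)) \<longlonglongrightarrow> inverse (eulerE q)"
    by (intro tendsto_inverse l eulerE_nonzero assms)
  then have "Bseq (\<lambda>n. inverse (qpoch q q n))" by (intro convergent_imp_Bseq) (auto simp: convergent_def)
  then obtain C2 where C2: "C2 > 0" "\<And>n. norm (inverse (qpoch q q n)) \<le> C2" by (auto simp: Bseq_def)
  show thesis
  proof (rule that[of "C1 * (C2 * C2)"])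
    show "norm (qbinom q n k) \<le> C1 * (C2 * C2)" for n k
    proof (cases "0 \<le> k \<and> k \<le> int n")
      case True
      then have "qbinom q n k = qpoch q q n * (inverse (qpoch q q (nat k)) * inverse (qpoch q q (nat (int n - k))))"
        by (simp add: qbinom_def field_simps)
      then show ?thesis
        using C1 C2 by (simp only: norm_mult) (intro mult_mono; simp)
    qed (use C1 C2 in \<open>auto simp: qbinom_def\<close>)
  qed (use C1 C2 in auto)
qed

lemma qbinom_0: "qbinom q 0 k = (if k = 0 then 1 else 0)"
  by (simp add: qbinom_def qpoch_0)

lemma infsum_int_shift: "(\<Sum>\<^sub>\<infinity>j. f (j + c :: int)) = infsum f UNIV"
  by (rule infsum_reindex_bij_witness[of _ "\<lambda>j. j - c" "\<lambda>j. j + c"]) auto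

lemma infsum_int_reflect: "(\<Sum>\<^sub>\<infinity>j. f (c - j :: int)) = infsum f UNIV"
  by (rule infsum_reindex_bij_witness[of _ "\<lambda>j. c - j" "\<lambda>j. c - j"]) auto

lemma inj_int_affine: "inj (\<lambda>j :: int. c + 2 * j)" "inj (\<lambda>j :: int. c + j)" "inj (\<lambda>j :: int. j)" "inj (\<lambda>j :: int. j - c)"
  by (auto simp: inj_on_def)

lemma minus_one_powi_minus_one_minus: "(- 1 :: complex) powi (- 1 - j) = - ((- 1) powi j)"
proof -
  have "(- 1 :: complex) powi (- 1 - j) = (- 1) powi (1 + j)" by (rule minus_one_powi_cong) auto
  then show ?thesis by (simp add: power_int_add)
qed

lemma minus_one_powi_one_minus: "(- 1 :: complex) powi (1 - j) = - ((- 1) powi j)"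
proof -
  have "(- 1 :: complex) powi (1 - j) = (- 1) powi (1 + j)" by (rule minus_one_powi_cong) auto
  then show ?thesis by (simp add: power_int_add)
qed

lemma infsum_int_nonneg:
  fixes f :: "nat \<Rightarrow> complex"
  assumes "\<And>n. g (int n) = f n" "\<And>n. n < 0 \<Longrightarrow> g n = 0" "(\<lambda>j. norm (g j)) summable_on UNIV"
  shows "infsum g UNIV = suminf f"
proof -
  have "infsum g UNIV = infsum g (range int)"
    by (rule infsum_cong_neutral) (use assms(2) in \<open>auto simp: image_iff\<close>, metis nat_0_le not_less)
  also have "\<dots> = infsum f UNIV"
    by (subst infsum_reindex) (auto simp: o_def assms(1))
  also have "\<dots> = suminf f"
  proof -
    have "g summable_on UNIV" by (rule abs_summable_summable[OF assms(3)])
    then have "g summable_on range int" by (rule summable_on_subset_banach) auto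
    then have "f summable_on UNIV"
      by (subst (asm) summable_on_reindex) (auto simp: o_def assms(1))
    then show ?thesis
      by (metis has_sum_imp_sums has_sum_infsum sums_unique)
  qed
  finally show ?thesis .
qed

section \<open>Finite forms of the Rogers-Ramanujan identities and of the triple product\<close>

context
  fixes t q :: complex
  assumes t: "norm t < 1" "t \<noteq> 0" and q: "q = t\<^sup>2"
begin

lemma q_bounds: "norm q < 1" "q \<noteq> 0"
  using t by (auto simp: q norm_power power_less_one_iff)

lemma q_powi: "q powi k = t powi (2 * k)"
  by (simp add: q power_int_power)

lemma q_power: "q ^ n = t powi (2 * int n)"
  using q_powi[of "int n"] by simp

lemmas tq_simps = q_powi q_power

lemma t_powi_mult: "t powi a * t powi b = t powi (a + b)"
  using t by (simp add: power_int_add)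

text \<open>Bressoud's finite form of the Rogers--Ramanujan identities: both pairs of sums satisfy the same
  first-order recurrence.\<close>

definition rrS where "rrS n = (\<Sum>\<^sub>\<infinity>j. t powi (2 * j\<^sup>2) * qbinom q n j)"
definition rrT where "rrT n = (\<Sum>\<^sub>\<infinity>j. t powi (2 * j\<^sup>2 + 2 * j) * qbinom q n j)"
definition rrS' where "rrS' n = (\<Sum>\<^sub>\<infinity>j. ((- 1) powi j * t powi (5 * j\<^sup>2 + j)) * qbinom q (2 * n) (int n + 2 * j))"
definition rrT' where "rrT' n = (\<Sum>\<^sub>\<infinity>j. ((- 1) powi j * t powi (5 * j\<^sup>2 - 3 * j)) * qbinom q (2 * n + 1) (int n + 2 * j))"

lemma rrS_Suc: "rrS (Suc n) = rrS n + q ^ Suc n * rrT n"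
proof -
  have "rrS (Suc n) = (\<Sum>\<^sub>\<infinity>j. t powi (2 * j\<^sup>2) * qbinom q n j + t powi (2 * j\<^sup>2 + 2 * (int (Suc n) - j)) * qbinom q n (j - 1))"
    unfolding rrS_def qbinom_Suc[OF q_bounds] tq_simps distrib_left mult.assoc[symmetric] t_powi_mult ..
  also have "\<dots> = rrS n + (\<Sum>\<^sub>\<infinity>j. t powi (2 * j\<^sup>2 + 2 * (int (Suc n) - j)) * qbinom q n (j - 1))"
    unfolding rrS_def by (intro infsum_add qbinom_summable inj_int_affine)
  also have "(\<Sum>\<^sub>\<infinity>j. t powi (2 * j\<^sup>2 + 2 * (int (Suc n) - j)) * qbinom q n (j - 1)) =
    (\<Sum>\<^sub>\<infinity>j. t powi (2 * (j + 1)\<^sup>2 + 2 * (int (Suc n) - (j + 1))) * qbinom q n ((j + 1) - 1))"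
    by (rule infsum_int_shift[symmetric])
  also have "\<dots> = (\<Sum>\<^sub>\<infinity>j. q ^ Suc n * (t powi (2 * j\<^sup>2 + 2 * j) * qbinom q n j))"
    unfolding tq_simps mult.assoc[symmetric] t_powi_mult
    by (intro infsum_cong arg_cong2[where f = "(*)"] arg_cong[where f = "power_int t"] arg_cong[where f = "qbinom q n"])
       (auto simp: power2_eq_square algebra_simps)
  also have "\<dots> = q ^ Suc n * rrT n"
    unfolding rrT_def by (rule infsum_cmult_right')
  finally show ?thesis .
qed

text \<open>Absorption replaces the Pascal rule: the factor 1 - q^(n+1) is traded for 1 - q^(n+1-j),
  and q^(j^2+j) q^(n+1-j) = q^(n+1) q^(j^2) turns the correction into a term of
  \<open>rrS (Suc n)\<close>.\<close>

lemma rrT_Suc: "rrT (Suc n) = q ^ Suc n * rrS (Suc n) + (1 - q ^ Suc n) * rrT n"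
proof -
  have "(1 - q ^ Suc n) * (t powi (2 * j\<^sup>2 + 2 * j) * qbinom q n j) =
    t powi (2 * j\<^sup>2 + 2 * j) * qbinom q (Suc n) j - q ^ Suc n * (t powi (2 * j\<^sup>2) * qbinom q (Suc n) j)" for j
  proof -
    have "(1 - q ^ Suc n) * (t powi (2 * j\<^sup>2 + 2 * j) * qbinom q n j) =
       t powi (2 * j\<^sup>2 + 2 * j) * ((1 - q powi (int (Suc n) - j)) * qbinom q (Suc n) j)"
      unfolding qbinom_absorb[OF q_bounds] by (simp add: mult_ac)
    also have "\<dots> = t powi (2 * j\<^sup>2 + 2 * j) * qbinom q (Suc n) j -
       (t powi (2 * j\<^sup>2 + 2 * j) * q powi (int (Suc n) - j)) * qbinom q (Suc n) j"
      by (simp add: algebra_simps)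
    also have "t powi (2 * j\<^sup>2 + 2 * j) * q powi (int (Suc n) - j) = q ^ Suc n * t powi (2 * j\<^sup>2)"
      unfolding tq_simps t_powi_mult by (simp add: algebra_simps)
    finally show ?thesis by (simp add: mult.assoc)
  qed
  then have "(1 - q ^ Suc n) * rrT n = (\<Sum>\<^sub>\<infinity>j. t powi (2 * j\<^sup>2 + 2 * j) * qbinom q (Suc n) j
       + (- (q ^ Suc n)) * (t powi (2 * j\<^sup>2) * qbinom q (Suc n) j))"
    unfolding rrT_def infsum_cmult_right'[symmetric] by simp
  also have "\<dots> = rrT (Suc n) + (\<Sum>\<^sub>\<infinity>j. (- (q ^ Suc n)) * (t powi (2 * j\<^sup>2) * qbinom q (Suc n) j))"
    unfolding rrT_def
    by (intro infsum_add summable_on_cmult_right qbinom_summable inj_int_affine)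
  also have "\<dots> = rrT (Suc n) - q ^ Suc n * rrS (Suc n)"
    unfolding rrS_def infsum_cmult_right' by simp
  finally show ?thesis by simp
qed

lemma rrS'_Suc: "rrS' (Suc n) = rrS' n + q ^ Suc n * rrT' n"
proof -
  \<comment> \<open>One Pascal rule is applied inside the mirrored one. This yields a copy of
    \<open>rrS' n\<close>, an antisymmetric sum \<open>?f\<close>, and a sum \<open>?g\<close> in
    which 5j^2 + j becomes 5j^2 - 3j, the exponent of \<open>rrT'\<close>.\<close>
  have P: "qbinom q (2 * Suc n) (int (Suc n) + 2 * j) = qbinom q (2 * n) (int n + 2 * j)
      + t powi (2 * (int n + 1 + 2 * j)) * qbinom q (2 * n) (int n + 1 + 2 * j)
      + t powi (2 * (int n + 1 - 2 * j)) * qbinom q (2 * n + 1) (int n + 2 * j)" for j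
  proof -
    have "qbinom q (2 * Suc n) (int (Suc n) + 2 * j) = qbinom q (Suc (2 * n)) (int (Suc n) + 2 * j)
        + q powi (int (Suc (2 * n + 1)) - (int (Suc n) + 2 * j)) * qbinom q (2 * n + 1) ((int (Suc n) + 2 * j) - 1)"
      using qbinom_Suc[OF q_bounds, of "2 * n + 1" "int (Suc n) + 2 * j"] by simp
    also have "qbinom q (Suc (2 * n)) (int (Suc n) + 2 * j) = qbinom q (2 * n) ((int (Suc n) + 2 * j) - 1) + 
        q powi (int (Suc n) + 2 * j) * qbinom q (2 * n) (int (Suc n) + 2 * j)"
      by (rule qbinom_Suc'[OF q_bounds])
    finally show ?thesis unfolding tq_simps by (simp add: algebra_simps)
  qed
  let ?f = "\<lambda>j. ((- 1) powi j * t powi (5 * j\<^sup>2 + j + 2 * (int n + 1 + 2 * j))) * qbinom q (2 * n) (int n + 1 + 2 * j)"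
  let ?g = "\<lambda>j. ((- 1) powi j * t powi (5 * j\<^sup>2 + j + 2 * (int n + 1 - 2 * j))) * qbinom q (2 * n + 1) (int n + 2 * j)"
  have "rrS' (Suc n) = (\<Sum>\<^sub>\<infinity>j. ((- 1) powi j * t powi (5 * j\<^sup>2 + j)) * qbinom q (2 * n) (int n + 2 * j) + ?f j + ?g j)"
    unfolding rrS'_def P t_powi_mult[symmetric] by (simp add: algebra_simps)
  also have "\<dots> = rrS' n + infsum ?f UNIV + infsum ?g UNIV"
    unfolding rrS'_def
    by (simp only: infsum_add summable_on_add qbinom_summable inj_int_affine)
  \<comment> \<open>The reflection j -> -1 - j fixes the exponent, carries the lower index n + 1 +
    2j to its mirror image in row 2n, and reverses the sign.\<close>
  also have "infsum ?f UNIV = 0"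
  proof -
    have "infsum ?f UNIV = (\<Sum>\<^sub>\<infinity>j. ?f (- 1 - j))" by (rule infsum_int_reflect[symmetric])
    also have "\<dots> = (\<Sum>\<^sub>\<infinity>j. - ?f j)"
    proof (rule infsum_cong)
      fix j :: int
      have "qbinom q (2 * n) (int n + 1 + 2 * (- 1 - j)) = qbinom q (2 * n) (int (2 * n) - (int n + 1 + 2 * j))"
        by (rule arg_cong[where f = "qbinom q (2 * n)"]) simp
      then have b: "qbinom q (2 * n) (int n + 1 + 2 * (- 1 - j)) = qbinom q (2 * n) (int n + 1 + 2 * j)"
        by (simp only: qbinom_sym)
      have e: "5 * (- 1 - j)\<^sup>2 + (- 1 - j) + 2 * (int n + 1 + 2 * (- 1 - j)) = 5 * j\<^sup>2 + j + 2 * (int n + 1 + 2 * j)"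
        by algebra
      show "?f (- 1 - j) = - ?f j"
        unfolding b e minus_one_powi_minus_one_minus by simp
    qed
    finally show ?thesis by (simp add: infsum_uminus)
  qed
  also have "infsum ?g UNIV = (\<Sum>\<^sub>\<infinity>j. q ^ Suc n * (((- 1) powi j * t powi (5 * j\<^sup>2 - 3 * j)) * qbinom q (2 * n + 1) (int n + 2 * j)))"
  proof (rule infsum_cong)
    fix j :: int
    have "q ^ Suc n * t powi (5 * j\<^sup>2 - 3 * j) = t powi (5 * j\<^sup>2 + j + 2 * (int n + 1 - 2 * j))"
      unfolding tq_simps t_powi_mult by (simp add: algebra_simps)
    then show "?g j = q ^ Suc n * (((- 1) powi j * t powi (5 * j\<^sup>2 - 3 * j)) * qbinom q (2 * n + 1) (int n + 2 * j))"
      by (metis (no_types, lifting) mult.assoc mult.left_commute)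
  qed
  also have "\<dots> = q ^ Suc n * rrT' n"
    unfolding rrT'_def by (rule infsum_cmult_right')
  finally show ?thesis by simp
qed

lemma rrT'_Suc: "rrT' (Suc n) = q ^ Suc n * rrS' (Suc n) + (1 - q ^ Suc n) * rrT' n"
proof -
  \<comment> \<open>Here the weight of \<open>?f\<close> turns 5j^2 - 3j into 5j^2 + j, which gives
    \<open>rrS' (Suc n)\<close>; the middle term is \<open>rrT' n\<close>.\<close>
  have P: "qbinom q (2 * Suc n + 1) (int (Suc n) + 2 * j) = t powi (2 * (int n + 1 + 2 * j)) * qbinom q (2 * Suc n) (int (Suc n) + 2 * j)
      + qbinom q (2 * n + 1) (int n + 2 * j)
      + t powi (2 * (int n + 2 - 2 * j)) * qbinom q (2 * n + 1) (int n - 1 + 2 * j)" for j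
  proof -
    have "qbinom q (2 * Suc n + 1) (int (Suc n) + 2 * j) = qbinom q (2 * Suc n) (int (Suc n) + 2 * j - 1)
        + q powi (int (Suc n) + 2 * j) * qbinom q (2 * Suc n) (int (Suc n) + 2 * j)"
      using qbinom_Suc'[OF q_bounds, of "2 * Suc n" "int (Suc n) + 2 * j"] by simp
    also have "qbinom q (2 * Suc n) (int (Suc n) + 2 * j - 1) = qbinom q (2 * n + 1) (int (Suc n) + 2 * j - 1)
        + q powi (int (Suc (2 * n + 1)) - (int (Suc n) + 2 * j - 1)) * qbinom q (2 * n + 1) (int (Suc n) + 2 * j - 1 - 1)"
      using qbinom_Suc[OF q_bounds, of "2 * n + 1" "int (Suc n) + 2 * j - 1"] by simp
    finally show ?thesis unfolding tq_simps by (simp add: algebra_simps)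
  qed
  let ?f = "\<lambda>j. ((- 1) powi j * t powi (5 * j\<^sup>2 - 3 * j + 2 * (int n + 1 + 2 * j))) * qbinom q (2 * Suc n) (int (Suc n) + 2 * j)"
  let ?g = "\<lambda>j. ((- 1) powi j * t powi (5 * j\<^sup>2 - 3 * j + 2 * (int n + 2 - 2 * j))) * qbinom q (2 * n + 1) (int n - 1 + 2 * j)"
  have "rrT' (Suc n) = (\<Sum>\<^sub>\<infinity>j. ?f j + ((- 1) powi j * t powi (5 * j\<^sup>2 - 3 * j)) * qbinom q (2 * n + 1) (int n + 2 * j) + ?g j)"
    unfolding rrT'_def P t_powi_mult[symmetric] by (simp add: algebra_simps)
  also have "\<dots> = infsum ?f UNIV + rrT' n + infsum ?g UNIV"
    unfolding rrT'_def
    by (simp only: infsum_add summable_on_add qbinom_summable inj_int_affine)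
  also have "infsum ?f UNIV = (\<Sum>\<^sub>\<infinity>j. q ^ Suc n * (((- 1) powi j * t powi (5 * j\<^sup>2 + j)) * qbinom q (2 * Suc n) (int (Suc n) + 2 * j)))"
  proof (rule infsum_cong)
    fix j :: int
    have "q ^ Suc n * t powi (5 * j\<^sup>2 + j) = t powi (5 * j\<^sup>2 - 3 * j + 2 * (int n + 1 + 2 * j))"
      unfolding tq_simps t_powi_mult by (simp add: algebra_simps)
    then show "?f j = q ^ Suc n * (((- 1) powi j * t powi (5 * j\<^sup>2 + j)) * qbinom q (2 * Suc n) (int (Suc n) + 2 * j))"
      by (metis (no_types, lifting) mult.assoc mult.left_commute)
  qed
  also have "\<dots> = q ^ Suc n * rrS' (Suc n)"
    unfolding rrS'_def by (rule infsum_cmult_right')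
  \<comment> \<open>The reflection j -> 1 - j carries the lower index n - 1 + 2j to the mirror image
    of n + 2j in row 2n + 1; its sign produces the term -q^(n+1) of the recurrence.\<close>
  also have "infsum ?g UNIV = (\<Sum>\<^sub>\<infinity>j. ?g (1 - j))" by (rule infsum_int_reflect[symmetric])
  also have "\<dots> = (\<Sum>\<^sub>\<infinity>j. (- (q ^ Suc n)) * (((- 1) powi j * t powi (5 * j\<^sup>2 - 3 * j)) * qbinom q (2 * n + 1) (int n + 2 * j)))"
  proof (rule infsum_cong)
    fix j :: int
    have "qbinom q (2 * n + 1) (int n - 1 + 2 * (1 - j)) = qbinom q (2 * n + 1) (int (2 * n + 1) - (int n + 2 * j))"
      by (rule arg_cong[where f = "qbinom q (2 * n + 1)"]) simp
    then have b: "qbinom q (2 * n + 1) (int n - 1 + 2 * (1 - j)) = qbinom q (2 * n + 1) (int n + 2 * j)"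
      by (simp only: qbinom_sym)
    have e: "5 * (1 - j)\<^sup>2 - 3 * (1 - j) + 2 * (int n + 2 - 2 * (1 - j)) = 2 * int (Suc n) + (5 * j\<^sup>2 - 3 * j)"
      by (simp add: power2_eq_square algebra_simps)
    show "?g (1 - j) = (- (q ^ Suc n)) * (((- 1) powi j * t powi (5 * j\<^sup>2 - 3 * j)) * qbinom q (2 * n + 1) (int n + 2 * j))"
      unfolding b e minus_one_powi_one_minus t_powi_mult[symmetric] q_power by (simp add: mult_ac)
  qed
  also have "\<dots> = - (q ^ Suc n) * rrT' n"
    unfolding rrT'_def by (rule infsum_cmult_right')
  finally show ?thesis by (simp add: algebra_simps)
qed

lemma rr_finite: "rrS n = rrS' n \<and> rrT n = rrT' n"
proof (induction n)
  case 0
  have d: "(\<Sum>\<^sub>\<infinity>j::int. if j = 0 then (1::complex) else 0) = 1"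
  proof -
    have "(\<Sum>\<^sub>\<infinity>j::int. if j = 0 then (1::complex) else 0) = (\<Sum>\<^sub>\<infinity>j\<in>{0::int}. 1)"
      by (rule infsum_cong_neutral) auto
    then show ?thesis by simp
  qed
  have 1: "qbinom q 1 (2 * j) = (if j = 0 then 1 else 0)" for j
    using qpoch_nonzero[OF q_bounds(1)] by (auto simp: qbinom_def qpoch_0)
  let ?d = "\<Sum>\<^sub>\<infinity>j::int. if j = 0 then (1::complex) else 0"
  have "rrS 0 = ?d" "rrT 0 = ?d" "rrS' 0 = ?d" "rrT' 0 = ?d"
    unfolding rrS_def rrT_def rrS'_def rrT'_def
    by (auto simp: qbinom_0 1[unfolded One_nat_def] intro!: infsum_cong)
  then show ?case by simp
next
  case (Suc n)
  then show ?case by (simp only: rrS_Suc rrT_Suc rrS'_Suc rrT'_Suc)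
qed

lemma tendsto_qbinom_sum:
  assumes "(\<lambda>j. norm (c j)) summable_on UNIV" "\<And>j. (\<lambda>n. qbinom q (N n) (\<alpha> n j)) \<longlonglongrightarrow> l j"
  shows "(\<lambda>n. \<Sum>\<^sub>\<infinity>j::int. c j * qbinom q (N n) (\<alpha> n j)) \<longlonglongrightarrow> (\<Sum>\<^sub>\<infinity>j. c j * l j)"
proof -
  obtain C where C: "C \<ge> 0" "\<And>n k. norm (qbinom q n k) \<le> C" using qbinom_bounded[OF q_bounds(1)] by blast
  show ?thesis
  proof (rule tendsto_infsum_dominated)
    show "(\<lambda>j. norm (c j) * C) summable_on UNIV" by (rule summable_on_cmult_left[OF assms(1)])
  qed (auto simp: norm_mult intro!: mult_left_mono C tendsto_mult tendsto_const assms)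
qed

text \<open>As n grows, the coefficients on the left tend to 1 / (q; q)_j and those on the right to
  1 / E(q). The parameters (e, b, d) are (0, 1, 0) for G and (1, -3, 1) for H.\<close>

lemma rogers_ramanujan_aux:
  assumes "\<And>n. (\<Sum>\<^sub>\<infinity>j. t powi (2 * j\<^sup>2 + 2 * e * j) * qbinom q n j) = (\<Sum>\<^sub>\<infinity>j. ((- 1) powi j * t powi (5 * j\<^sup>2 + b * j)) * qbinom q (2 * n + d) (int n + 2 * j))"
  shows "(\<Sum>n. t powi (2 * (int n)\<^sup>2 + 2 * e * int n) / qpoch q q n) * eulerE q = theta 5 b (- 1) t"
proof -
  let ?l = "\<lambda>j. if j < 0 then 0 else 1 / qpoch q q (nat j)"
  have s1: "(\<lambda>j. norm (t powi (2 * j\<^sup>2 + 2 * e * j))) summable_on UNIV"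
    using theta_summable[of 1 t 2 "2 * e"] t by simp
  have s2: "(\<lambda>j. norm ((- 1) powi j * t powi (5 * j\<^sup>2 + b * j))) summable_on UNIV"
    using theta_summable[of "- 1" t 5 b] t by simp
  have l: "(\<lambda>n. qbinom q n j) \<longlonglongrightarrow> ?l j" for j
  proof (cases "j < 0")
    case True
    then show ?thesis by (simp add: qbinom_def)
  next
    case False
    then show ?thesis using qbinom_tendsto_fixed[OF q_bounds(1), of "nat j"] by simp
  qed
  obtain C where C: "C \<ge> 0" "\<And>n k. norm (qbinom q n k) \<le> C" using qbinom_bounded[OF q_bounds(1)] by blast
  have "(\<lambda>j. norm (t powi (2 * j\<^sup>2 + 2 * e * j) * ?l j)) summable_on UNIV"
  proof (rule Infinite_Sum.abs_summable_on_comparison_test')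
    show "(\<lambda>j. norm (t powi (2 * j\<^sup>2 + 2 * e * j)) * C) summable_on UNIV" by (rule summable_on_cmult_left[OF s1])
    fix j :: int
    have "norm (?l j) \<le> C"
      by (rule tendsto_upperbound[OF tendsto_norm[OF l]]) (auto simp: C(2))
    then show "norm (t powi (2 * j\<^sup>2 + 2 * e * j) * ?l j) \<le> norm (t powi (2 * j\<^sup>2 + 2 * e * j)) * C"
      by (simp only: norm_mult) (rule mult_left_mono; simp)
  qed
  then have S: "(\<Sum>\<^sub>\<infinity>j. t powi (2 * j\<^sup>2 + 2 * e * j) * ?l j) = (\<Sum>n. t powi (2 * (int n)\<^sup>2 + 2 * e * int n) / qpoch q q n)"
    by (intro infsum_int_nonneg) auto
  have 1: "(\<lambda>n. \<Sum>\<^sub>\<infinity>j. t powi (2 * j\<^sup>2 + 2 * e * j) * qbinom q n j) \<longlonglongrightarrow> (\<Sum>n. t powi (2 * (int n)\<^sup>2 + 2 * e * int n) / qpoch q q n)"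
    unfolding S[symmetric] by (rule tendsto_qbinom_sum[OF s1 l])
  have 2: "(\<lambda>n. \<Sum>\<^sub>\<infinity>j. ((- 1) powi j * t powi (5 * j\<^sup>2 + b * j)) * qbinom q (2 * n + d) (int n + 2 * j)) \<longlonglongrightarrow>
      (\<Sum>\<^sub>\<infinity>j. ((- 1) powi j * t powi (5 * j\<^sup>2 + b * j)) * (1 / eulerE q))"
    by (rule tendsto_qbinom_sum[OF s2 qbinom_tendsto_central[OF q_bounds(1)]])
  have "(\<Sum>n. t powi (2 * (int n)\<^sup>2 + 2 * e * int n) / qpoch q q n) = (\<Sum>\<^sub>\<infinity>j. ((- 1) powi j * t powi (5 * j\<^sup>2 + b * j)) * (1 / eulerE q))"
    by (rule LIMSEQ_unique[OF 1 2[folded assms]])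
  also have "\<dots> = theta 5 b (- 1) t * (1 / eulerE q)"
    unfolding theta_def by (rule infsum_cmult_left')
  finally show ?thesis using eulerE_nonzero[OF q_bounds(1)] by simp
qed

lemma rrG_theta: "rrG q * eulerE q = theta 5 1 (- 1) t"
proof -
  have "rrG q = (\<Sum>n. t powi (2 * (int n)\<^sup>2 + 2 * 0 * int n) / qpoch q q n)"
    unfolding rrG_def q_power by simp
  moreover have "(\<Sum>n. t powi (2 * (int n)\<^sup>2 + 2 * 0 * int n) / qpoch q q n) * eulerE q = theta 5 1 (- 1) t"
    by (rule rogers_ramanujan_aux[where d = 0]) (use rr_finite in \<open>simp add: rrS_def rrS'_def\<close>)
  ultimately show ?thesis by (simp only:)
qed

lemma rrH_theta: "rrH q * eulerE q = theta 5 3 (- 1) t"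
proof -
  have "rrH q = (\<Sum>n. t powi (2 * (int n)\<^sup>2 + 2 * 1 * int n) / qpoch q q n)"
    unfolding rrH_def q_power by (simp add: power2_eq_square algebra_simps)
  moreover have "(\<Sum>n. t powi (2 * (int n)\<^sup>2 + 2 * 1 * int n) / qpoch q q n) * eulerE q = theta 5 (- 3) (- 1) t"
    by (rule rogers_ramanujan_aux[where d = 1]) (use rr_finite in \<open>simp add: rrT_def rrT'_def\<close>)
  moreover have "theta 5 (- 3) (- 1) t = theta 5 3 (- 1) t" by (simp add: theta_neg)
  ultimately show ?thesis by (simp only:)
qed

text \<open>The induction goes from row 2n to row 2n + 2 through the odd row: one Pascal rule
  contributes the factor 1 + z q^n, and the mirrored one contributes 1 + q^(n+1) / z.\<close>

lemma finite_jacobi: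
  assumes "z \<noteq> 0"
  shows "qpoch (- z) q n * qpoch (- q / z) q n = (\<Sum>\<^sub>\<infinity>j. (z powi j * t powi (j\<^sup>2 - j)) * qbinom q (2 * n) (int n + j))"
proof (induction n)
  case 0
  have "(\<Sum>\<^sub>\<infinity>j. (z powi j * t powi (j\<^sup>2 - j)) * qbinom q 0 (0 + j)) = (\<Sum>\<^sub>\<infinity>j\<in>{0::int}. 1)"
    by (rule infsum_cong_neutral) (auto simp: qbinom_0)
  then show ?case by (simp add: qpoch_0)
next
  case (Suc n)
  let ?c = "\<lambda>j. z powi j * t powi (j\<^sup>2 - j)"
  let ?F = "\<Sum>\<^sub>\<infinity>j. ?c j * qbinom q (2 * n) (int n + j)"
  let ?O = "\<Sum>\<^sub>\<infinity>j. ?c j * qbinom q (2 * n + 1) (int n + j)"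
  have O: "?O = (1 + z * q ^ n) * ?F"
  proof -
    have P: "qbinom q (2 * n + 1) (int n + j) = qbinom q (2 * n) (int n + j) + t powi (2 * (int n + 1 - j)) * qbinom q (2 * n) (int n + (j - 1))" for j
      using qbinom_Suc[OF q_bounds, of "2 * n" "int n + j"] unfolding q_powi by (simp add: algebra_simps)
    have "?O = (\<Sum>\<^sub>\<infinity>j. ?c j * qbinom q (2 * n) (int n + j) + (?c j * t powi (2 * (int n + 1 - j))) * qbinom q (2 * n) (int n + (j - 1)))"
      unfolding P by (simp add: algebra_simps)
    also have "\<dots> = ?F + (\<Sum>\<^sub>\<infinity>j. (?c j * t powi (2 * (int n + 1 - j))) * qbinom q (2 * n) (int n + (j - 1)))"
      by (intro infsum_add qbinom_summable) (auto simp: inj_on_def)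
    also have "(\<Sum>\<^sub>\<infinity>j. (?c j * t powi (2 * (int n + 1 - j))) * qbinom q (2 * n) (int n + (j - 1))) =
       (\<Sum>\<^sub>\<infinity>j. (?c (j + 1) * t powi (2 * (int n + 1 - (j + 1)))) * qbinom q (2 * n) (int n + ((j + 1) - 1)))"
      by (rule infsum_int_shift[symmetric])
    also have "\<dots> = (\<Sum>\<^sub>\<infinity>j. z * q ^ n * (?c j * qbinom q (2 * n) (int n + j)))"
    proof (rule infsum_cong)
      fix j :: int
      have e: "(j + 1)\<^sup>2 - (j + 1) + 2 * (int n + 1 - (j + 1)) = 2 * int n + (j\<^sup>2 - j)" by algebra
      have "?c (j + 1) * t powi (2 * (int n + 1 - (j + 1))) = z * q ^ n * ?c j"
        unfolding mult.assoc t_powi_mult e q_power using assms t by (simp add: power_int_add mult_ac)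
      then show "(?c (j + 1) * t powi (2 * (int n + 1 - (j + 1)))) * qbinom q (2 * n) (int n + ((j + 1) - 1)) =
          z * q ^ n * (?c j * qbinom q (2 * n) (int n + j))" by simp
    qed
    also have "\<dots> = z * q ^ n * ?F" by (rule infsum_cmult_right')
    finally show ?thesis by (simp add: algebra_simps)
  qed
  have "(\<Sum>\<^sub>\<infinity>j. ?c j * qbinom q (2 * Suc n) (int (Suc n) + j)) = (1 + q ^ Suc n / z) * ?O"
  proof -
    have P: "qbinom q (2 * Suc n) (int (Suc n) + j) = qbinom q (2 * n + 1) (int n + j) + t powi (2 * (int n + 1 + j)) * qbinom q (2 * n + 1) (int n + (j + 1))" for j
      using qbinom_Suc'[OF q_bounds, of "2 * n + 1" "int n + 1 + j"] unfolding q_powi by (simp add: algebra_simps)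
    have "(\<Sum>\<^sub>\<infinity>j. ?c j * qbinom q (2 * Suc n) (int (Suc n) + j)) = (\<Sum>\<^sub>\<infinity>j. ?c j * qbinom q (2 * n + 1) (int n + j) + (?c j * t powi (2 * (int n + 1 + j))) * qbinom q (2 * n + 1) (int n + (j + 1)))"
      unfolding P by (simp add: algebra_simps)
    also have "\<dots> = ?O + (\<Sum>\<^sub>\<infinity>j. (?c j * t powi (2 * (int n + 1 + j))) * qbinom q (2 * n + 1) (int n + (j + 1)))"
      by (intro infsum_add qbinom_summable) (auto simp: inj_on_def)
    also have "(\<Sum>\<^sub>\<infinity>j. (?c j * t powi (2 * (int n + 1 + j))) * qbinom q (2 * n + 1) (int n + (j + 1))) =
      (\<Sum>\<^sub>\<infinity>j. (?c (j + (- 1)) * t powi (2 * (int n + 1 + (j + (- 1))))) * qbinom q (2 * n + 1) (int n + ((j + (- 1)) + 1)))"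
      by (rule infsum_int_shift[symmetric])
    also have "\<dots> = (\<Sum>\<^sub>\<infinity>j. q ^ Suc n / z * (?c j * qbinom q (2 * n + 1) (int n + j)))"
    proof (rule infsum_cong)
      fix j :: int
      have e: "(j + (- 1))\<^sup>2 - (j + (- 1)) + 2 * (int n + 1 + (j + (- 1))) = 2 * int (Suc n) + (j\<^sup>2 - j)"
        by (simp add: power2_eq_square algebra_simps)
      have "?c (j + (- 1)) * t powi (2 * (int n + 1 + (j + (- 1)))) = q ^ Suc n / z * ?c j"
        unfolding mult.assoc t_powi_mult e q_power using assms t by (simp add: power_int_add power_int_diff divide_simps)
      then show "(?c (j + (- 1)) * t powi (2 * (int n + 1 + (j + (- 1))))) * qbinom q (2 * n + 1) (int n + ((j + (- 1)) + 1)) =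
          q ^ Suc n / z * (?c j * qbinom q (2 * n + 1) (int n + j))" by simp
    qed
    also have "\<dots> = q ^ Suc n / z * ?O" by (rule infsum_cmult_right')
    finally show ?thesis by (simp add: algebra_simps)
  qed
  then show ?case
    unfolding O Suc.IH[symmetric] by (simp add: qpoch_Suc mult_ac)
qed

lemma jacobi_triple_product:
  assumes "z \<noteq> 0" "(\<lambda>j. norm (z powi j * t powi (j\<^sup>2 - j))) summable_on UNIV"
  shows "qpoch_inf (- z) q * qpoch_inf (- q / z) q * eulerE q = (\<Sum>\<^sub>\<infinity>j. z powi j * t powi (j\<^sup>2 - j))"
proof -
  have "(\<lambda>n. \<Sum>\<^sub>\<infinity>j. (z powi j * t powi (j\<^sup>2 - j)) * qbinom q (2 * n + 0) (int n + j)) \<longlonglongrightarrow>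
      (\<Sum>\<^sub>\<infinity>j. (z powi j * t powi (j\<^sup>2 - j)) * (1 / eulerE q))"
    by (rule tendsto_qbinom_sum[OF assms(2) qbinom_tendsto_central[OF q_bounds(1)]])
  moreover have "(\<lambda>n. qpoch (- z) q n * qpoch (- q / z) q n) \<longlonglongrightarrow> qpoch_inf (- z) q * qpoch_inf (- q / z) q"
    by (intro tendsto_mult qpoch_tendsto q_bounds)
  ultimately have "qpoch_inf (- z) q * qpoch_inf (- q / z) q = (\<Sum>\<^sub>\<infinity>j. (z powi j * t powi (j\<^sup>2 - j)) * (1 / eulerE q))"
    unfolding finite_jacobi[OF assms(1)] add_0_right by (rule LIMSEQ_unique[rotated])
  also have "\<dots> = (\<Sum>\<^sub>\<infinity>j. z powi j * t powi (j\<^sup>2 - j)) * (1 / eulerE q)"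
    by (rule infsum_cmult_left')
  finally show ?thesis using eulerE_nonzero[OF q_bounds(1)] by simp
qed

end

section \<open>Theta series as infinite products\<close>

lemma qpoch_dissect_3:
  "qpoch x x (3 * n) = qpoch x (x ^ 3) n * qpoch (x ^ 2) (x ^ 3) n * qpoch (x ^ 3) (x ^ 3) n"
proof (induction n)
  case (Suc n)
  have "3 * Suc n = Suc (Suc (Suc (3 * n)))" by simp
  moreover have "x * x ^ (3 * n) = x * (x ^ 3) ^ n" "x * x ^ Suc (3 * n) = x\<^sup>2 * (x ^ 3) ^ n"
      "x * x ^ Suc (Suc (3 * n)) = x ^ 3 * (x ^ 3) ^ n"
    by (simp_all add: power_mult power2_eq_square power3_eq_cube)
  ultimately show ?case by (simp only: qpoch_Suc Suc) (simp add: mult_ac)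
qed (simp add: qpoch_0)

lemma qpoch_dissect_5:
  "qpoch x x (5 * n) = qpoch x (x ^ 5) n * qpoch (x ^ 2) (x ^ 5) n * qpoch (x ^ 3) (x ^ 5) n *
    qpoch (x ^ 4) (x ^ 5) n * qpoch (x ^ 5) (x ^ 5) n"
proof (induction n)
  case (Suc n)
  have "5 * Suc n = Suc (Suc (Suc (Suc (Suc (5 * n)))))" by simp
  moreover have "x * x ^ (5 * n) = x * (x ^ 5) ^ n" "x * x ^ Suc (5 * n) = x\<^sup>2 * (x ^ 5) ^ n"
      "x * x ^ Suc (Suc (5 * n)) = x ^ 3 * (x ^ 5) ^ n"
      "x * x ^ Suc (Suc (Suc (5 * n))) = x ^ 4 * (x ^ 5) ^ n"
      "x * x ^ Suc (Suc (Suc (Suc (5 * n)))) = x ^ 5 * (x ^ 5) ^ n"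
  proof -
    have w: "x * (x * w) = x\<^sup>2 * w" "x * (x * (x * w)) = x ^ 3 * w" "x * (x * (x * (x * w))) = x ^ 4 * w"
      "x * (x * (x * (x * (x * w)))) = x ^ 5 * w" for w
      by (simp_all add: eval_nat_numeral mult_ac)
    show "x * x ^ (5 * n) = x * (x ^ 5) ^ n" "x * x ^ Suc (5 * n) = x\<^sup>2 * (x ^ 5) ^ n"
      "x * x ^ Suc (Suc (5 * n)) = x ^ 3 * (x ^ 5) ^ n"
      "x * x ^ Suc (Suc (Suc (5 * n))) = x ^ 4 * (x ^ 5) ^ n"
      "x * x ^ Suc (Suc (Suc (Suc (5 * n)))) = x ^ 5 * (x ^ 5) ^ n"
      by (simp_all only: power_Suc power_mult) (rule w)+
  qed
  ultimately show ?case by (simp only: qpoch_Suc Suc) (simp add: mult_ac)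
qed (simp add: qpoch_0)

lemma filterlim_mult_nat: "k > 0 \<Longrightarrow> filterlim (\<lambda>n. k * n :: nat) at_top sequentially"
  by (rule filterlim_at_top_mono[OF filterlim_ident]) auto

lemma norm_power_lt_1: "norm (x :: complex) < 1 \<Longrightarrow> k > 0 \<Longrightarrow> norm (x ^ k) < 1"
  by (simp add: norm_power power_less_one_iff)

lemma eulerE_dissect_3:
  assumes "norm x < 1"
  shows "eulerE x = qpoch_inf x (x ^ 3) * qpoch_inf (x ^ 2) (x ^ 3) * eulerE (x ^ 3)"
proof -
  have "(\<lambda>n. qpoch x x (3 * n)) \<longlonglongrightarrow> eulerE x"
    by (intro tendsto_qpoch_shift assms filterlim_mult_nat) simp
  moreover have "(\<lambda>n. qpoch x x (3 * n)) \<longlonglongrightarrow> qpoch_inf x (x ^ 3) * qpoch_inf (x ^ 2) (x ^ 3) * eulerE (x ^ 3)"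
    unfolding qpoch_dissect_3 eulerE_def
    by (intro tendsto_mult qpoch_tendsto norm_power_lt_1 assms) simp_all
  ultimately show ?thesis by (rule LIMSEQ_unique)
qed

lemma eulerE_dissect_5:
  assumes "norm x < 1"
  shows "eulerE x = qpoch_inf x (x ^ 5) * qpoch_inf (x ^ 2) (x ^ 5) * qpoch_inf (x ^ 3) (x ^ 5) *
     qpoch_inf (x ^ 4) (x ^ 5) * eulerE (x ^ 5)"
proof -
  have "(\<lambda>n. qpoch x x (5 * n)) \<longlonglongrightarrow> eulerE x"
    by (intro tendsto_qpoch_shift assms filterlim_mult_nat) simp
  moreover have "(\<lambda>n. qpoch x x (5 * n)) \<longlonglongrightarrow> qpoch_inf x (x ^ 5) * qpoch_inf (x ^ 2) (x ^ 5) * qpoch_inf (x ^ 3) (x ^ 5) *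
     qpoch_inf (x ^ 4) (x ^ 5) * eulerE (x ^ 5)"
    unfolding qpoch_dissect_5 eulerE_def
    by (intro tendsto_mult qpoch_tendsto norm_power_lt_1 assms) simp_all
  ultimately show ?thesis by (rule LIMSEQ_unique)
qed

text \<open>Jacobi's triple product with t^k in place of t and z = -t^(2l); the exponent k (j^2 - j)
  + 2l j is the one of the theta series.\<close>

lemma theta_triple_product:
  assumes "norm t < 1" "t \<noteq> 0" "k > 0" "2 * l < 2 * k"
  shows "theta (int k) (2 * int l - int k) (- 1) t =
    qpoch_inf ((t\<^sup>2) ^ l) ((t\<^sup>2) ^ k) * qpoch_inf ((t\<^sup>2) ^ (k - l)) ((t\<^sup>2) ^ k) * eulerE ((t\<^sup>2) ^ k)"
proof -
  let ?z = "- (t ^ (2 * l))"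
  have e: "?z powi j * (t ^ k) powi (j\<^sup>2 - j) = (- 1) powi j * t powi (int k * j\<^sup>2 + (2 * int l - int k) * j)" for j
  proof -
    have "?z = (- 1) * t ^ (2 * l)" by simp
    then have "?z powi j = (- 1) powi j * t powi (2 * int l * j)"
      by (simp only: power_int_mult_distrib power_int_power) simp
    moreover have "(t ^ k) powi (j\<^sup>2 - j) = t powi (int k * (j\<^sup>2 - j))"
      by (rule power_int_power)
    ultimately show ?thesis
      using assms(2) by (simp add: power_int_add[symmetric] algebra_simps)
  qed
  have z: "?z \<noteq> 0" using assms by simp
  have s: "(\<lambda>j. norm (?z powi j * (t ^ k) powi (j\<^sup>2 - j))) summable_on UNIV"
    unfolding e by (rule theta_summable) (use assms in auto)
  have tk: "norm (t ^ k) < 1" "t ^ k \<noteq> 0" using assms norm_power_lt_1 by auto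
  have *: "(t ^ k)\<^sup>2 = (t\<^sup>2) ^ k" by (simp add: power_mult[symmetric] mult.commute)
  have **: "- ((t\<^sup>2) ^ k) / ?z = (t\<^sup>2) ^ (k - l)"
  proof -
    have "2 * k = 2 * l + 2 * (k - l)" using assms(4) by simp
    then have "(t ^ k)\<^sup>2 = t ^ (2 * l) * (t\<^sup>2) ^ (k - l)"
      by (simp only: power_mult[symmetric] power_add[symmetric] mult.commute[of k])
    then show ?thesis using assms(2) unfolding * by simp
  qed
  have "theta (int k) (2 * int l - int k) (- 1) t = (\<Sum>\<^sub>\<infinity>j. ?z powi j * (t ^ k) powi (j\<^sup>2 - j))"
    unfolding theta_def e ..
  also have "\<dots> = qpoch_inf (- ?z) ((t ^ k)\<^sup>2) * qpoch_inf (- (t ^ k)\<^sup>2 / ?z) ((t ^ k)\<^sup>2) * eulerE ((t ^ k)\<^sup>2)"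
    by (rule jacobi_triple_product[OF tk refl z s, symmetric])
  finally show ?thesis unfolding * ** by (simp add: power_mult)
qed

text \<open>Euler's pentagonal number theorem: for k = 3 and l = 1 the three products are the
  residue classes modulo 3 of the product E.\<close>

lemma eulerE_theta:
  assumes "norm t < 1" "t \<noteq> 0"
  shows "eulerE (t\<^sup>2) = theta 3 1 (- 1) t"
proof -
  have "theta 3 (- 1) (- 1) t = qpoch_inf (t\<^sup>2) ((t\<^sup>2) ^ 3) * qpoch_inf ((t\<^sup>2) ^ 2) ((t\<^sup>2) ^ 3) * eulerE ((t\<^sup>2) ^ 3)"
    using theta_triple_product[OF assms, of 3 1] by simp
  also have "\<dots> = eulerE (t\<^sup>2)"
    by (rule eulerE_dissect_3[symmetric]) (use assms norm_power_lt_1 in auto)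
  finally show ?thesis by (simp add: theta_neg)
qed

text \<open>With x = t^2 this is the relation G(x) H(x) = E(x^5) / E(x). The triple products with k
  = 5 and l = 1, 2 together contain each nonzero residue class modulo 5 once and E(x^5)
  twice.\<close>

lemma theta_rr_product:
  assumes "norm t < 1" "t \<noteq> 0"
  shows "theta 5 1 (- 1) t * theta 5 3 (- 1) t = theta 3 1 (- 1) t * theta 15 5 (- 1) t"
proof -
  have 1: "theta 5 (- 1) (- 1) t = qpoch_inf ((t\<^sup>2) ^ 2) ((t\<^sup>2) ^ 5) * qpoch_inf ((t\<^sup>2) ^ 3) ((t\<^sup>2) ^ 5) * eulerE ((t\<^sup>2) ^ 5)"
    using theta_triple_product[OF assms, of 5 2] by simp
  have 2: "theta 5 (- 3) (- 1) t = qpoch_inf (t\<^sup>2) ((t\<^sup>2) ^ 5) * qpoch_inf ((t\<^sup>2) ^ 4) ((t\<^sup>2) ^ 5) * eulerE ((t\<^sup>2) ^ 5)"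
    using theta_triple_product[OF assms, of 5 1] by simp
  have "(t\<^sup>2) ^ 5 = (t ^ 5)\<^sup>2" by (simp add: power_mult[symmetric])
  then have 3: "eulerE ((t\<^sup>2) ^ 5) = theta 15 5 (- 1) t"
    using eulerE_theta[of "t ^ 5"] assms norm_power_lt_1[of t 5] theta_power[of 3 1 "- 1" t 5] by simp
  have 4: "theta 3 1 (- 1) t = qpoch_inf (t\<^sup>2) ((t\<^sup>2) ^ 5) * qpoch_inf ((t\<^sup>2) ^ 2) ((t\<^sup>2) ^ 5) * qpoch_inf ((t\<^sup>2) ^ 3) ((t\<^sup>2) ^ 5) *
     qpoch_inf ((t\<^sup>2) ^ 4) ((t\<^sup>2) ^ 5) * eulerE ((t\<^sup>2) ^ 5)"
    unfolding eulerE_theta[OF assms, symmetric]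
    by (rule eulerE_dissect_5) (use assms norm_power_lt_1 in auto)
  have "theta 5 (- 1) (- 1) t * theta 5 (- 3) (- 1) t = theta 3 1 (- 1) t * theta 15 5 (- 1) t"
    unfolding 1 2 3[symmetric] 4 by (simp only: mult_ac)
  then show ?thesis by (simp add: theta_neg)
qed

section \<open>Holomorphy, values at 0, and the functions phi and psi\<close>

text \<open>Prepares the statement on zeros of the denominators. The bound on \<open>b\<close> keeps
  all exponents nonnegative, so the origin is included; on smaller balls the value of each term at a
  real radius is a majorant.\<close>

lemma theta_holomorphic:
  assumes "norm s = 1" "a > 0" "\<bar>b\<bar> \<le> a"
  shows "theta a b s holomorphic_on ball 0 1"
proof -
  have e: "a * n\<^sup>2 + b * n \<ge> 0" for n :: int
  proof -
    have "\<bar>b * n\<bar> \<le> a * n\<^sup>2"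
    proof -
      have "\<bar>n\<bar> \<le> n\<^sup>2" using self_le_power[of "\<bar>n\<bar>" 2] by (cases "n = 0") auto
      then show ?thesis unfolding abs_mult by (intro mult_mono assms(3)) (use assms in auto)
    qed
    then show ?thesis by linarith
  qed
  have "theta a b s holomorphic_on ball 0 r" if r: "0 < r" "r < 1" for r
  proof -
    let ?f = "\<lambda>n t. s powi n * t powi (a * n\<^sup>2 + b * n)"
    have h: "?f n holomorphic_on A" for n A
      using e[of n] by (auto simp: power_int_nonneg_exp intro!: holomorphic_intros)
    have s: "(\<lambda>n. norm (?f n (complex_of_real r))) summable_on UNIV"
      by (rule theta_summable) (use assms r in auto)
    have ul: "uniform_limit (cball 0 r) (\<lambda>X t. \<Sum>n\<in>X. ?f n t) (\<lambda>t. \<Sum>\<^sub>\<infinity>n. ?f n t) (finite_subsets_at_top UNIV)"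
    proof (rule Weierstrass_m_test_general[OF _ s])
      fix n t assume "t \<in> cball (0 :: complex) r"
      then have "norm t ^ nat (a * n\<^sup>2 + b * n) \<le> r ^ nat (a * n\<^sup>2 + b * n)"
        by (intro power_mono) auto
      then show "norm (?f n t) \<le> norm (?f n (complex_of_real r))"
        using e[of n] assms r by (auto simp: norm_mult norm_power power_int_nonneg_exp intro: mult_left_mono)
    qed
    have "continuous_on (cball 0 r) (\<lambda>t. \<Sum>\<^sub>\<infinity>n. ?f n t) \<and> (\<lambda>t. \<Sum>\<^sub>\<infinity>n. ?f n t) holomorphic_on ball 0 r"
    proof (rule holomorphic_uniform_limit[OF _ ul])
      show "\<forall>\<^sub>F X in finite_subsets_at_top UNIV. continuous_on (cball 0 r) (\<lambda>t. \<Sum>n\<in>X. ?f n t) \<and> (\<lambda>t. \<Sum>n\<in>X. ?f n t) holomorphic_on ball 0 r"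
        by (intro always_eventually allI conjI holomorphic_on_sum holomorphic_on_imp_continuous_on h)
    qed auto
    then show ?thesis unfolding theta_def by simp
  qed
  then have "\<exists>r. t \<in> ball 0 r \<and> theta a b s holomorphic_on ball 0 r" if "t \<in> ball 0 1" for t :: complex
    using that dense[of "norm t" 1] by (metis dist_0_norm mem_ball norm_ge_zero le_less_trans)
  then have "\<exists>d>0. theta a b s holomorphic_on ball t d" if "t \<in> ball 0 1" for t :: complex
    by (metis that open_contains_ball_eq open_ball holomorphic_on_subset)
  then show ?thesis
    by (metis analytic_on_def analytic_imp_holomorphic)
qed

text \<open>The strict bound on \<open>b\<close> leaves n = 0 as the only zero of the exponent, and
  0 to the power 0 is 1.\<close>

lemma theta_0:
  assumes "a > 0" "\<bar>b\<bar> < a"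
  shows "theta a b s 0 = 1"
proof -
  have e: "a * n\<^sup>2 + b * n \<noteq> 0" if "n \<noteq> 0" for n
  proof
    assume "a * n\<^sup>2 + b * n = 0"
    then have "n * (a * n + b) = 0" by (simp add: power2_eq_square algebra_simps)
    then have "a * n + b = 0" using that by (simp only: mult_eq_0_iff) simp
    then have "b = (- n) * a" by algebra
    then have "\<bar>b\<bar> = \<bar>n\<bar> * a" using assms by (simp add: abs_mult)
    moreover have "1 * a \<le> \<bar>n\<bar> * a" using that assms by (intro mult_right_mono) auto
    ultimately show False using assms by simp
  qed
  have "theta a b s 0 = (\<Sum>\<^sub>\<infinity>n\<in>{0::int}. 1)"
    unfolding theta_def by (rule infsum_cong_neutral) (use e in auto)
  then show ?thesis by simp
qed

lemma ramphi_theta: "ramphi (- t) = theta 1 0 (- 1) t"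
proof -
  have "(- t) powi n\<^sup>2 = (- 1) powi n * t powi n\<^sup>2" for n :: int
  proof -
    have "(- t) powi n\<^sup>2 = ((- 1) * t) powi n\<^sup>2" by simp
    also have "\<dots> = (- 1) powi n\<^sup>2 * t powi n\<^sup>2" by (rule power_int_mult_distrib)
    also have "(- 1 :: complex) powi n\<^sup>2 = (- 1) powi n" by (rule minus_one_powi_cong) auto
    finally show ?thesis .
  qed
  then show ?thesis by (simp add: ramphi_def theta_def)
qed

text \<open>The map n -> -1 - n fixes n^2 + n and exchanges negative and nonnegative indices, so the
  bilateral series counts psi twice.\<close>

lemma rampsi_theta:
  assumes "norm t < 1" "t \<noteq> 0"
  shows "2 * rampsi (t\<^sup>2) = theta 1 1 1 t"
proof -
  let ?f = "\<lambda>n. t powi (n\<^sup>2 + n)"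
  have s: "(\<lambda>n. norm (?f n)) summable_on UNIV"
    using theta_summable[of 1 t 1 1] assms by simp
  let ?A = "{0::int..}" and ?B = "{..<0::int}"
  have f: "?f summable_on X" for X
    by (rule summable_on_subset_banach[OF abs_summable_summable[OF s]]) auto
  have "theta 1 1 1 t = infsum ?f (?A \<union> ?B)"
    unfolding theta_def by (rule infsum_cong_neutral) auto
  also have "\<dots> = infsum ?f ?A + infsum ?f ?B"
    by (rule infsum_Un_disjoint[OF f f]) auto
  also have "infsum ?f ?B = infsum ?f ?A"
    by (rule infsum_reindex_bij_witness[of _ "\<lambda>n. - 1 - n" "\<lambda>n. - 1 - n"]) (auto simp: power2_eq_square algebra_simps)
  also have "infsum ?f ?A = infsum (\<lambda>n. if n < 0 then 0 else ?f n) UNIV"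
    by (rule infsum_cong_neutral) auto
  also have "\<dots> = (\<Sum>n. t powi ((int n)\<^sup>2 + int n))"
  proof (rule infsum_int_nonneg)
    show "(\<lambda>n. norm (if n < 0 then 0 else ?f n)) summable_on UNIV"
      by (rule Infinite_Sum.abs_summable_on_comparison_test'[OF s]) auto
  qed auto
  also have "\<dots> = rampsi (t\<^sup>2)"
    unfolding rampsi_def
  proof (rule arg_cong[where f = suminf], rule ext)
    fix n :: nat
    have "2 * (n * (n + 1) div 2) = n * (n + 1)" by simp
    then have "(t\<^sup>2) ^ (n * (n + 1) div 2) = t ^ (n * (n + 1))"
      by (simp only: power_mult[symmetric])
    moreover have "(int n)\<^sup>2 + int n = int (n * (n + 1))"
      by (simp add: power2_eq_square algebra_simps)
    ultimately show "t powi ((int n)\<^sup>2 + int n) = (t\<^sup>2) ^ (n * (n + 1) div 2)"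
      by (simp only: power_int_of_nat)
  qed
  finally show ?thesis by simp
qed

lemma bqseries_0:
  assumes "a > 0" "b\<^sup>2 < 4 * a * c"
  shows "bqseries a b c 0 = 1"
proof -
  have "a * n\<^sup>2 + b * n * m + c * m\<^sup>2 \<noteq> 0" if "n \<noteq> 0 \<or> m \<noteq> 0" for n m
    using form_lower_bound[OF assms, of n m] that sum_power2_gt_zero_iff[of n m] by auto
  then have "bqseries a b c 0 = (\<Sum>\<^sub>\<infinity>x\<in>{(0::int, 0::int)}. 1)"
    unfolding bqseries_def by (intro infsum_cong_neutral) (auto, blast+)
  then show ?thesis by simp
qed

section \<open>The theta identities in the variable \<open>q\<close>\<close>

context
  fixes q :: complex
  assumes q: "norm q < 1" "q \<noteq> 0"
begin

lemma theta_minus: "theta a (- b) (- 1) q = theta a b (- 1) q"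
  by (simp add: theta_neg)

lemma q_pow: "k > 0 \<Longrightarrow> norm (q ^ k) < 1" "q ^ k \<noteq> 0"
  using q norm_power_lt_1 by auto

text \<open>Key to the numerals below: with x = q^8, the function E at x^j is the case k = 4j. Thus
  \<open>theta 12 4\<close>, \<open>theta 24 8\<close>, \<open>theta 156 52\<close> and
  \<open>theta 312 104\<close> at sign -1 are E_1, E_2, E_13 and E_26.\<close>

lemma eulerE_q: "k > 0 \<Longrightarrow> eulerE (q ^ (2 * k)) = theta (3 * int k) (int k) (- 1) q"
  using eulerE_theta[OF q_pow[of k]] by (simp add: theta_power power_mult[symmetric] mult.commute)

lemma rrG_q: "k > 0 \<Longrightarrow> rrG (q ^ (2 * k)) * eulerE (q ^ (2 * k)) = theta (5 * int k) (int k) (- 1) q"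
  using rrG_theta[OF q_pow[of k] refl] by (simp add: theta_power power_mult[symmetric] mult.commute)

lemma rrH_q: "k > 0 \<Longrightarrow> rrH (q ^ (2 * k)) * eulerE (q ^ (2 * k)) = theta (5 * int k) (3 * int k) (- 1) q"
  using rrH_theta[OF q_pow[of k] refl] by (simp add: theta_power power_mult[symmetric] mult.commute)

lemma theta_rr_product_q: "k > 0 \<Longrightarrow>
  theta (5 * int k) (int k) (- 1) q * theta (5 * int k) (3 * int k) (- 1) q = theta (3 * int k) (int k) (- 1) q * theta (15 * int k) (5 * int k) (- 1) q"
  using theta_rr_product[OF q_pow[of k]] by (simp add: theta_power mult.commute)

lemma theta_nonzero: "k > 0 \<Longrightarrow> theta (3 * int k) (int k) (- 1) q \<noteq> 0"
  using eulerE_nonzero[of "q ^ (2 * k)"] q_pow[of "2 * k"] by (simp add: eulerE_q)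

lemma theta_rr_nonzero:
  assumes "k > 0"
  shows "theta (5 * int k) (int k) (- 1) q \<noteq> 0" "theta (5 * int k) (3 * int k) (- 1) q \<noteq> 0"
  using theta_rr_product_q[OF assms] theta_nonzero[OF assms] theta_nonzero[of "5 * k"] assms by auto

text \<open>For \<open>x = q\<^bsup>2 k\<^esup> = z\<^sup>5\<close> the bracketed sums are, up to sign, the parts of the pentagonal number
  series of \<open>E(z)\<close> with exponents \<open>0\<close> and \<open>2\<close> modulo \<open>5\<close>; the identities say that these are
  \<open>E(x\<^sup>5) G(x) / H(x)\<close> and \<open>E(x\<^sup>5) H(x) / G(x)\<close>.\<close>

lemma dissection_q:
  assumes "k > 0"
  shows "(theta (15 * int k) (int k) (- 1) q + q ^ (2 * k) * theta (15 * int k) (11 * int k) (- 1) q) * theta (3 * int k) (int k) (- 1) q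
      = (theta (5 * int k) (int k) (- 1) q)\<^sup>2" (is "?J0 * ?E = ?g\<^sup>2")
    and "(theta (15 * int k) (7 * int k) (- 1) q + q ^ (4 * k) * theta (15 * int k) (17 * int k) (- 1) q) * theta (3 * int k) (int k) (- 1) q
      = (theta (5 * int k) (3 * int k) (- 1) q)\<^sup>2" (is "?J2 * ?E = ?h\<^sup>2")
proof -
  let ?E5 = "theta (15 * int k) (5 * int k) (- 1) q"
  have 1: "?h * ?J0 = ?E5 * ?g" and 2: "?g * ?J2 = ?E5 * ?h"
    using hexagonal_theta_1[OF q_pow(1)[OF assms] q_pow(2)] hexagonal_theta_2[OF q_pow(1)[OF assms] q_pow(2)]
    by (simp_all add: theta_power power_mult[symmetric] mult.commute)
  note 3 = theta_rr_product_q[OF assms] and 4 = theta_rr_nonzero[OF assms]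
  have "?h * (?J0 * ?E) = (?g * ?h) * ?g" unfolding 3 mult.assoc[symmetric] 1 by (simp only: mult_ac)
  then show "?J0 * ?E = ?g\<^sup>2" using 4 by (simp add: power2_eq_square)
  have "?g * (?J2 * ?E) = (?g * ?h) * ?h" unfolding 3 mult.assoc[symmetric] 2 by (simp only: mult_ac)
  then show "?J2 * ?E = ?h\<^sup>2" using 4 by (simp add: power2_eq_square)
qed

section \<open>The alternating sums as products of theta series\<close>

text \<open>Here 3 (5k^2 + 8kr + 24r^2) = 2 (k + 6r)^2 + 13k^2, and the odd multiples of 3
  cancel.\<close>

lemma alt_bqseries_5: "alt_bqseries 2 1 5 8 24 q = 2 * q ^ 5 * (theta 24 8 (- 1) q * theta 156 52 (- 1) q)"
proof -
  have "alt_bqseries 6 1 5 8 24 q = q ^ 5 * (theta 24 8 (- 1) q * theta 156 52 (- 1) q)"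
    using theta_theta_eq_alt_bqseries[of 3 5 2 1 13 1 1 0 5 q] q by simp
  moreover have "alt_bqseries 6 3 5 8 24 q = 0"
    using alt_bqseries_vanish[of 3 1 24 8 5 q] by simp
  ultimately show ?thesis using alt_bqseries_2_6[of 5 8 24 q] q by simp
qed

text \<open>Here 3 (9k^2 + 4kr + 12r^2) = (k + 6r)^2 + 26k^2.\<close>

lemma alt_bqseries_9: "alt_bqseries 2 1 9 4 12 q = 2 * q ^ 9 * (theta 12 4 (- 1) q * theta 312 104 (- 1) q)"
proof -
  have "alt_bqseries 6 1 9 4 12 q = q ^ 9 * (theta 12 4 (- 1) q * theta 312 104 (- 1) q)"
    using theta_theta_eq_alt_bqseries[of 3 9 1 1 26 1 1 0 9 q] q by simp
  moreover have "alt_bqseries 6 3 9 4 12 q = 0"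
    using alt_bqseries_vanish[of 3 1 12 4 9 q] by simp
  ultimately show ?thesis using alt_bqseries_2_6[of 9 4 12 q] q by simp
qed

text \<open>Here 5 (3k^2 + 8kr + 40r^2) = 2 (k + 10r)^2 + 13k^2. The classes 1 and -1 of k modulo 10
  give the G terms, 3 and -3 the H terms, and the odd multiples of 5 cancel.\<close>

lemma alt_bqseries_3: "alt_bqseries 2 1 3 8 40 q = 2 * q ^ 3 * (theta 40 8 (- 1) q * theta 260 52 (- 1) q
    + q ^ 24 * (theta 40 24 (- 1) q * theta 260 156 (- 1) q))"
proof -
  have "alt_bqseries 10 1 3 8 40 q = q ^ 3 * (theta 40 8 (- 1) q * theta 260 52 (- 1) q)"
    using theta_theta_eq_alt_bqseries[of 5 3 2 1 13 1 1 0 3 q] q by simp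
  moreover have "alt_bqseries 10 3 3 8 40 q = q ^ 27 * (theta 40 24 (- 1) q * theta 260 156 (- 1) q)"
    using theta_theta_eq_alt_bqseries[of 5 3 2 1 13 3 3 0 27 q] q by simp
  moreover have "alt_bqseries 10 5 3 8 40 q = 0"
    using alt_bqseries_vanish[of 5 1 40 8 3 q] by simp
  moreover have "q ^ 27 = q ^ 3 * q ^ 24" by (simp flip: power_add)
  moreover have "alt_bqseries 2 1 3 8 40 q = 2 * (alt_bqseries 10 1 3 8 40 q + alt_bqseries 10 3 3 8 40 q) + alt_bqseries 10 5 3 8 40 q"
    by (rule alt_bqseries_2_10) (use q in auto)
  ultimately show ?thesis by (simp only: distrib_left mult.assoc add_0_right)
qed

text \<open>Here 5 (7k^2 + 12kr + 20r^2) = (3k + 10r)^2 + 26k^2. The multiplier 3 pairs H with G.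
  For k = 3 it gives 9 = -1 + 10, and this single shift is the source of the minus sign in U(1,
  26).\<close>

lemma alt_bqseries_7: "alt_bqseries 2 1 7 12 20 q = 2 * q ^ 7 * (theta 20 12 (- 1) q * theta 520 104 (- 1) q
    - q ^ 40 * (theta 20 4 (- 1) q * theta 520 312 (- 1) q))"
proof -
  have "alt_bqseries 10 1 7 12 20 q = q ^ 7 * (theta 20 12 (- 1) q * theta 520 104 (- 1) q)"
    using theta_theta_eq_alt_bqseries[of 5 7 1 3 26 1 3 0 7 q] q by simp
  moreover have "alt_bqseries 10 3 7 12 20 q = - (q ^ 47 * (theta 20 4 (- 1) q * theta 520 312 (- 1) q))"
    using theta_theta_eq_alt_bqseries[of 5 7 1 3 26 3 "-1" 1 47 q] q by (simp add: theta_minus)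
  moreover have "alt_bqseries 10 5 7 12 20 q = 0"
    using alt_bqseries_vanish[of 5 3 20 12 7 q] by simp
  moreover have "q ^ 47 = q ^ 7 * q ^ 40" by (simp flip: power_add)
  moreover have "alt_bqseries 2 1 7 12 20 q = 2 * (alt_bqseries 10 1 7 12 20 q + alt_bqseries 10 3 7 12 20 q) + alt_bqseries 10 5 7 12 20 q"
    by (rule alt_bqseries_2_10) (use q in auto)
  ultimately show ?thesis
    by (simp only: distrib_left mult.assoc add_0_right diff_conv_add_uminus mult_minus_right)
qed

text \<open>For h = 15, A = 2, B = 13 the multipliers \<mu> = 1 and \<mu> = -11 give the forms (1,
  8, 120) and (17, -88, 120). Up to sign, (s, k) modulo 30 runs through (1, 1), (7, 7), (17, 17),
  (11, 11), (5, 5) for the first and (11, 1), (17, 7), (7, 17), (1, 11), (5, 5) for the second. The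
  brackets consist of the residues 1, 11 and 7, 17, so the two lists are their diagonal and cross
  terms, and 5 occurs twice.\<close>

lemma alt_bqseries_1_9:
  "alt_bqseries 2 1 1 0 104 q - alt_bqseries 2 1 9 4 12 q = 2 * q *
    ((theta 120 8 (- 1) q + q ^ 16 * theta 120 88 (- 1) q) * (theta 780 52 (- 1) q + q ^ 104 * theta 780 572 (- 1) q)
     + 2 * q ^ 24 * (theta 120 40 (- 1) q * theta 780 260 (- 1) q)
     + q ^ 48 * ((theta 120 56 (- 1) q + q ^ 32 * theta 120 136 (- 1) q) * (theta 780 364 (- 1) q + q ^ 208 * theta 780 884 (- 1) q)))"
proof -
  have sh: "alt_bqseries 30 13 a b c q = alt_bqseries 30 (- 17) a b c q" for a b c
    using alt_bqseries_shift[of 30 "-17" a b c q] by simp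
  have A: "alt_bqseries 6 1 1 8 120 q = q * (theta 120 8 (- 1) q * theta 780 52 (- 1) q) + q ^ 49 * (theta 120 56 (- 1) q * theta 780 364 (- 1) q)
     + q ^ 289 * (theta 120 136 (- 1) q * theta 780 884 (- 1) q) + q ^ 121 * (theta 120 88 (- 1) q * theta 780 572 (- 1) q)
     + q ^ 25 * (theta 120 40 (- 1) q * theta 780 260 (- 1) q)"
    using theta_theta_eq_alt_bqseries[of 15 1 2 1 13 1 1 0 1 q] theta_theta_eq_alt_bqseries[of 15 1 2 1 13 7 7 0 49 q]
      theta_theta_eq_alt_bqseries[of 15 1 2 1 13 "-17" "-17" 0 289 q] theta_theta_eq_alt_bqseries[of 15 1 2 1 13 "-11" "-11" 0 121 q]
      theta_theta_eq_alt_bqseries[of 15 1 2 1 13 "-5" "-5" 0 25 q] alt_bqseries_6_30[of 1 8 120 q] q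
    by (simp add: theta_minus sh)
  have B: "alt_bqseries 6 1 17 (- 88) 120 q = q ^ 17 * (theta 120 88 (- 1) q * theta 780 52 (- 1) q) + q ^ 81 * (theta 120 136 (- 1) q * theta 780 364 (- 1) q)
     + q ^ 257 * (theta 120 56 (- 1) q * theta 780 884 (- 1) q) + q ^ 105 * (theta 120 8 (- 1) q * theta 780 572 (- 1) q)
     + q ^ 25 * (theta 120 40 (- 1) q * theta 780 260 (- 1) q)"
    using theta_theta_eq_alt_bqseries[of 15 17 2 "-11" 13 1 "-11" 0 17 q] theta_theta_eq_alt_bqseries[of 15 17 2 "-11" 13 7 "-17" "-2" 81 q]
      theta_theta_eq_alt_bqseries[of 15 17 2 "-11" 13 "-17" 7 6 257 q] theta_theta_eq_alt_bqseries[of 15 17 2 "-11" 13 "-11" 1 4 105 q]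
      theta_theta_eq_alt_bqseries[of 15 17 2 "-11" 13 "-5" "-5" 2 25 q] alt_bqseries_6_30[of 17 "-88" 120 q] q
    by (simp add: theta_minus sh power_int_minus)
  \<comment> \<open>Both sums are carried to forms with last coefficient 120 = 4 h A. The shear has
    odd parameter and changes the sign, so the difference becomes a sum.\<close>
  have "alt_bqseries 2 1 1 0 104 q = alt_bqseries 2 1 1 8 120 q"
    using alt_bqseries_add_even[of 1 0 104 q] alt_bqseries_add_even[of 1 4 108 q] by simp
  moreover have "alt_bqseries 2 1 17 (- 88) 120 q = - alt_bqseries 2 1 9 4 12 q"
    using alt_bqseries_add_even[of 17 "-88" 120 q] alt_bqseries_shear[of 2 1 9 4 12 q "-1"] by simp
  moreover have "alt_bqseries 2 1 1 8 120 q = 2 * alt_bqseries 6 1 1 8 120 q + alt_bqseries 6 3 1 8 120 q"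
    "alt_bqseries 2 1 17 (- 88) 120 q = 2 * alt_bqseries 6 1 17 (- 88) 120 q + alt_bqseries 6 3 17 (- 88) 120 q"
    by (rule alt_bqseries_2_6; use q in simp)+
  \<comment> \<open>On multiples of 3 the two forms are equivalent through a shear with odd
    parameter, so their contributions cancel in the sum.\<close>
  moreover have "alt_bqseries 6 3 17 (- 88) 120 q = - alt_bqseries 6 3 1 8 120 q"
    using alt_bqseries_shear[of 2 1 153 "-264" 120 q 1] alt_bqseries_reflect[of 2 1 9 24 120 q] by (simp add: alt_bqseries_6_3)
  ultimately have "alt_bqseries 2 1 1 0 104 q - alt_bqseries 2 1 9 4 12 q = 2 * (alt_bqseries 6 1 1 8 120 q + alt_bqseries 6 1 17 (- 88) 120 q)"
    by algebra
  moreover have "q ^ 49 = q * q ^ 48" "q ^ 289 = q * q ^ 48 * q ^ 32 * q ^ 208" "q ^ 121 = q * q ^ 16 * q ^ 104"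
      "q ^ 25 = q * q ^ 24" "q ^ 17 = q * q ^ 16" "q ^ 81 = q * q ^ 48 * q ^ 32" "q ^ 257 = q * q ^ 48 * q ^ 208"
      "q ^ 105 = q * q ^ 104"
    by (simp_all flip: power_add power_Suc)
  ultimately show ?thesis unfolding A B by (simp only: algebra_simps mult_2 mult_2_right)
qed

text \<open>The same mechanism with A = 1, B = 26 and the multipliers 7 and 13, which are 2 and -2
  modulo 5. Hence residues 7, 17 of s are now paired with 1, 11 of k and conversely. On multiples of
  3 the two forms are equivalent by a shear with even parameter, so these parts cancel in the
  difference.\<close>

lemma alt_bqseries_5_13:
  "alt_bqseries 2 1 5 8 24 q - alt_bqseries 2 1 13 0 8 q = 2 * q ^ 5 *
    ((theta 60 28 (- 1) q + q ^ 16 * theta 60 68 (- 1) q) * (theta 1560 104 (- 1) q + q ^ 208 * theta 1560 1144 (- 1) q)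
     - 2 * q ^ 40 * (theta 60 20 (- 1) q * theta 1560 520 (- 1) q)
     + q ^ 80 * ((theta 60 4 (- 1) q + q ^ 8 * theta 60 44 (- 1) q) * (theta 1560 728 (- 1) q + q ^ 416 * theta 1560 1768 (- 1) q)))"
proof -
  have sh: "alt_bqseries 30 13 a b c q = alt_bqseries 30 (- 17) a b c q" for a b c
    using alt_bqseries_shift[of 30 "-17" a b c q] by simp
  have A: "alt_bqseries 6 1 5 28 60 q = q ^ 5 * (theta 60 28 (- 1) q * theta 1560 104 (- 1) q) + q ^ 93 * (theta 60 44 (- 1) q * theta 1560 728 (- 1) q)
     + q ^ 501 * (theta 60 4 (- 1) q * theta 1560 1768 (- 1) q) + q ^ 229 * (theta 60 68 (- 1) q * theta 1560 1144 (- 1) q)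
     - q ^ 45 * (theta 60 20 (- 1) q * theta 1560 520 (- 1) q)"
    using theta_theta_eq_alt_bqseries[of 15 5 1 7 26 1 7 0 5 q] theta_theta_eq_alt_bqseries[of 15 5 1 7 26 7 "-11" 2 93 q]
      theta_theta_eq_alt_bqseries[of 15 5 1 7 26 "-17" 1 "-4" 501 q] theta_theta_eq_alt_bqseries[of 15 5 1 7 26 "-11" "-17" "-2" 229 q]
      theta_theta_eq_alt_bqseries[of 15 5 1 7 26 "-5" "-5" "-1" 45 q] alt_bqseries_6_30[of 5 28 60 q] q
    by (simp add: theta_minus sh power_int_minus)
  have B: "alt_bqseries 6 1 13 52 60 q = - (q ^ 21 * (theta 60 68 (- 1) q * theta 1560 104 (- 1) q)) - q ^ 85 * (theta 60 4 (- 1) q * theta 1560 728 (- 1) q)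
     - q ^ 509 * (theta 60 44 (- 1) q * theta 1560 1768 (- 1) q) - q ^ 213 * (theta 60 28 (- 1) q * theta 1560 1144 (- 1) q)
     + q ^ 45 * (theta 60 20 (- 1) q * theta 1560 520 (- 1) q)"
    using theta_theta_eq_alt_bqseries[of 15 13 1 13 26 1 "-17" 1 21 q] theta_theta_eq_alt_bqseries[of 15 13 1 13 26 7 1 3 85 q]
      theta_theta_eq_alt_bqseries[of 15 13 1 13 26 "-17" "-11" "-7" 509 q] theta_theta_eq_alt_bqseries[of 15 13 1 13 26 "-11" 7 "-5" 213 q]
      theta_theta_eq_alt_bqseries[of 15 13 1 13 26 "-5" "-5" "-2" 45 q] alt_bqseries_6_30[of 13 52 60 q] q
    by (simp add: theta_minus sh power_int_minus)
  have "alt_bqseries 2 1 5 8 24 q = alt_bqseries 2 1 5 28 60 q"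
    using alt_bqseries_add_even[of 5 8 24 q] by simp
  moreover have "alt_bqseries 2 1 13 0 8 q = alt_bqseries 2 1 13 52 60 q"
    using alt_bqseries_add_even[of 13 0 8 q] by simp
  moreover have "alt_bqseries 2 1 5 28 60 q = 2 * alt_bqseries 6 1 5 28 60 q + alt_bqseries 6 3 5 28 60 q"
    "alt_bqseries 2 1 13 52 60 q = 2 * alt_bqseries 6 1 13 52 60 q + alt_bqseries 6 3 13 52 60 q"
    by (rule alt_bqseries_2_6; use q in simp)+
  moreover have "alt_bqseries 6 3 5 28 60 q = alt_bqseries 6 3 13 52 60 q"
    using alt_bqseries_shear[of 2 1 45 84 60 q "-2"] alt_bqseries_reflect[of 2 1 117 156 60 q] by (simp add: alt_bqseries_6_3 power_int_minus)
  ultimately have "alt_bqseries 2 1 5 8 24 q - alt_bqseries 2 1 13 0 8 q = 2 * (alt_bqseries 6 1 5 28 60 q - alt_bqseries 6 1 13 52 60 q)"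
    by (simp add: algebra_simps)
  moreover have p: "q ^ 93 = q ^ 5 * q ^ 80 * q ^ 8" "q ^ 501 = q ^ 5 * q ^ 80 * q ^ 416" "q ^ 229 = q ^ 5 * q ^ 16 * q ^ 208"
      "q ^ 45 = q ^ 5 * q ^ 40" "q ^ 21 = q ^ 5 * q ^ 16" "q ^ 85 = q ^ 5 * q ^ 80" "q ^ 509 = q ^ 5 * q ^ 80 * q ^ 8 * q ^ 416"
      "q ^ 213 = q ^ 5 * q ^ 208"
    by (simp_all flip: power_add)
  moreover have "2 * (p * (c * b) + p * w * e * (a' * d) + p * w * f * (a * d') + p * s * u * (c' * b') - p * v * (x * y)
      - (- (p * s * (c' * b)) - p * w * (a * d) - p * w * e * f * (a' * d') - p * u * (c * b') + p * v * (x * y)))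
    = 2 * p * ((c + s * c') * (b + u * b') - 2 * v * (x * y) + w * ((a + e * a') * (d + f * d')))"
    for p w e f s u v a a' b b' c c' d d' x y :: complex
    by algebra
  ultimately show ?thesis unfolding A B p by (simp only:)
qed

text \<open>A second splitting of the same sum, from 3 (35k^2 + 208kr + 312r^2) = k^2 + 104 (k +
  3r)^2. With x = q^8 and y = q^104 the products are 2 psi(x^3) phi(-y^3) and f(x, x^2) f(-y,
  -y^5).\<close>

lemma alt_bqseries_3_alt: "alt_bqseries 2 1 3 8 40 q = q ^ 3 * (theta 12 12 1 q * theta 312 0 (- 1) q) - 2 * q ^ 35 * (theta 12 4 1 q * theta 312 208 (- 1) q)"
proof -
  have "alt_bqseries 2 1 35 208 312 q = 2 * q ^ 35 * (theta 12 4 1 q * theta 312 208 (- 1) q) - q ^ 3 * (theta 12 12 1 q * theta 312 0 (- 1) q)"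
    using alt_bqseries_mod_3[OF q, of 35 1 13] alt_bqseries_2_6[of 35 208 312 q] q by simp
  moreover have "alt_bqseries 2 1 35 208 312 q = - alt_bqseries 2 1 3 8 40 q"
    using alt_bqseries_add_even[of 35 68 36 q] alt_bqseries_shear[of 2 1 3 "-4" 36 q 1] alt_bqseries_add_even[of 3 "-4" 36 q] by simp
  ultimately show ?thesis by (simp add: algebra_simps minus_equation_iff)
qed

text \<open>The counterpart with x and y exchanged, from 3 (7k^2 + 16kr + 24r^2) = 13k^2 + 8 (k +
  3r)^2; the products are f(y, y^2) f(-x, -x^5) and 2 psi(y^3) phi(-x^3).\<close>

lemma alt_bqseries_7_alt: "alt_bqseries 2 1 7 12 20 q = 2 * q ^ 7 * (theta 156 52 1 q * theta 24 16 (- 1) q) - q ^ 39 * (theta 156 156 1 q * theta 24 0 (- 1) q)"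
proof -
  have "alt_bqseries 2 1 7 16 24 q = 2 * q ^ 7 * (theta 156 52 1 q * theta 24 16 (- 1) q) - q ^ 39 * (theta 156 156 1 q * theta 24 0 (- 1) q)"
    using alt_bqseries_mod_3[OF q, of 7 13 1] alt_bqseries_2_6[of 7 16 24 q] q by simp
  moreover have "alt_bqseries 2 1 7 16 24 q = alt_bqseries 2 1 7 12 20 q"
    using alt_bqseries_reflect[of 2 1 7 16 24 q] alt_bqseries_add_even[of 7 "-16" 24 q] by simp
  ultimately show ?thesis by simp
qed

lemma theta_parity_q:
  assumes "k > 0"
  shows "theta (3 * int k) (3 * int k) 1 q * theta (3 * int k) (int k) (- 1) q = 2 * (theta (6 * int k) (4 * int k) (- 1) q * theta (6 * int k) (2 * int k) (- 1) q)"
    and "theta (6 * int k) 0 (- 1) q * theta (6 * int k) (2 * int k) (- 1) q = theta (3 * int k) (int k) 1 q * theta (3 * int k) (int k) (- 1) q"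
  using theta_parity_1[OF q_pow(1)[OF assms] q_pow(2)] theta_parity_2[OF q_pow(1)[OF assms] q_pow(2)]
  by (simp_all add: theta_power mult.commute)

text \<open>This is \<open>U(1, 26) = U(2, 13)\<close>. In the representations modulo \<open>3\<close> of the two sides, corresponding
  products agree by the parity dissections.\<close>

lemma alt_bqseries_cross_product: "q ^ 4 * (alt_bqseries 2 1 3 8 40 q * (theta 12 4 (- 1) q * theta 312 104 (- 1) q)) =
    alt_bqseries 2 1 7 12 20 q * (theta 24 8 (- 1) q * theta 156 52 (- 1) q)"
proof -
  have "theta 12 12 1 q * theta 12 4 (- 1) q = 2 * (theta 24 16 (- 1) q * theta 24 8 (- 1) q)"
    "theta 24 0 (- 1) q * theta 24 8 (- 1) q = theta 12 4 1 q * theta 12 4 (- 1) q"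
    "theta 156 156 1 q * theta 156 52 (- 1) q = 2 * (theta 312 208 (- 1) q * theta 312 104 (- 1) q)"
    "theta 312 0 (- 1) q * theta 312 104 (- 1) q = theta 156 52 1 q * theta 156 52 (- 1) q"
    using theta_parity_q[of 4] theta_parity_q[of 52] by simp_all
  then show ?thesis unfolding alt_bqseries_3_alt alt_bqseries_7_alt by algebra
qed

lemma alt_bqseries_1: "alt_bqseries 2 1 1 0 104 q = 2 * q * rampsi (q ^ 8) * ramphi (- (q ^ 104))"
  using alt_bqseries_diagonal[OF q, of 1 104] rampsi_theta[OF q_pow[of 4]]
  by (simp add: ramphi_theta theta_power power_mult[symmetric])

lemma alt_bqseries_13: "alt_bqseries 2 1 13 0 8 q = 2 * q ^ 13 * rampsi (q ^ 104) * ramphi (- (q ^ 8))"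
  using alt_bqseries_diagonal[OF q, of 13 8] rampsi_theta[OF q_pow[of 52]]
  by (simp add: ramphi_theta theta_power power_mult[symmetric])

text \<open>The theorem lists reduced forms, while \<open>bqseries_diff\<close> may produce other
  members of their classes, for example (3, 8, 144) for (3, 2, 139). Shifts, swaps and sign changes
  connect them.\<close>

lemma bqseries_alt_bqseries:
  "bqseries 3 2 139 q - bqseries 12 4 35 q = alt_bqseries 2 1 3 8 40 q"
  "bqseries 7 4 60 q - bqseries 15 4 28 q = alt_bqseries 2 1 7 12 20 q"
  "bqseries 9 8 48 q - bqseries 17 6 25 q = alt_bqseries 2 1 9 4 12 q"
  "bqseries 5 4 84 q - bqseries 20 4 21 q = alt_bqseries 2 1 5 8 24 q"
  "bqseries 13 0 32 q - bqseries 21 10 21 q = alt_bqseries 2 1 13 0 8 q"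
  "bqseries 1 0 416 q - bqseries 4 4 105 q = alt_bqseries 2 1 1 0 104 q"
proof -
  show "bqseries 3 2 139 q - bqseries 12 4 35 q = alt_bqseries 2 1 3 8 40 q"
    using bqseries_diff[of 3 4 36 q] bqseries_shift[of 3 2 139 q 1] bqseries_shift[of 12 20 43 q "-1"] bqseries_neg[of 12 4 35 q]
      alt_bqseries_reflect[of 2 1 3 4 36 q] alt_bqseries_add_even[of 3 "-4" 36 q] q by simp
  show "bqseries 7 4 60 q - bqseries 15 4 28 q = alt_bqseries 2 1 7 12 20 q"
    using bqseries_diff[of 7 "-12" 20 q] bqseries_shift[of 7 4 60 q "-2"] bqseries_swap[of 28 4 15 q]
      alt_bqseries_reflect[of 2 1 7 12 20 q] q by simp
  show "bqseries 9 8 48 q - bqseries 17 6 25 q = alt_bqseries 2 1 9 4 12 q"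
    using bqseries_diff[of 9 4 12 q] bqseries_shift[of 25 44 36 q "-1"] bqseries_swap[of 36 44 25 q] bqseries_swap[of 25 6 17 q]
      bqseries_neg[of 25 6 17 q] q by simp
  show "bqseries 5 4 84 q - bqseries 20 4 21 q = alt_bqseries 2 1 5 8 24 q"
    using bqseries_diff[of 5 12 28 q] bqseries_shift[of 5 4 84 q 2] bqseries_shift[of 20 44 45 q "-1"]
      alt_bqseries_reflect[of 2 1 5 12 28 q] alt_bqseries_add_even[of 5 "-12" 28 q] q by simp
  show "bqseries 13 0 32 q - bqseries 21 10 21 q = alt_bqseries 2 1 13 0 8 q"
    using bqseries_diff[of 13 0 8 q] bqseries_swap[of 52 52 21 q] bqseries_shift[of 21 52 52 q "-1"] q by simp
  show "bqseries 1 0 416 q - bqseries 4 4 105 q = alt_bqseries 2 1 1 0 104 q"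
    using bqseries_diff[of 1 0 104 q] q by simp
qed

end

section \<open>The functions \<open>U\<close>\<close>

text \<open>Division-free version of w + 2c + c^2 / w = (g g' + c h h')^2 / (g g' h h') for w = g g'
  / (h h'), applied with c = x^3 and c = -x^5 where x = q^8.\<close>

lemma square_of_dissections:
  fixes g h :: complex
  assumes "J0 * E = g\<^sup>2" "J2 * E = h\<^sup>2" "J0' * E' = g'\<^sup>2" "J2' * E' = h'\<^sup>2"
    and "g * h = E * E5" "g' * h' = E' * E5'"
  shows "(J0 * J0' + 2 * c * (E5 * E5') + c\<^sup>2 * (J2 * J2')) * (E * E') = (g * g' + c * (h * h'))\<^sup>2"
proof -
  have "(J0 * J0' + 2 * c * (E5 * E5') + c\<^sup>2 * (J2 * J2')) * (E * E') =
    (J0 * E) * (J0' * E') + 2 * c * ((E * E5) * (E' * E5')) + c\<^sup>2 * ((J2 * E) * (J2' * E'))"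
    by (simp add: algebra_simps)
  also have "\<dots> = g\<^sup>2 * g'\<^sup>2 + 2 * c * ((g * h) * (g' * h')) + c\<^sup>2 * (h\<^sup>2 * h'\<^sup>2)"
    by (simp only: assms)
  also have "\<dots> = (g * g' + c * (h * h'))\<^sup>2"
    by (simp add: power2_eq_square algebra_simps)
  finally show ?thesis .
qed

context
  fixes q :: complex
  assumes q: "norm q < 1" "q \<noteq> 0"
begin

lemma rrU_2_13:
  "theta 24 8 (- 1) q * theta 156 52 (- 1) q * rrU 2 13 (q ^ 8) =
    theta 40 8 (- 1) q * theta 260 52 (- 1) q + q ^ 24 * (theta 40 24 (- 1) q * theta 260 156 (- 1) q)"
proof -
  have "rrU 2 13 (q ^ 8) = rrG (q ^ 16) * rrG (q ^ 104) + q ^ 24 * rrH (q ^ 16) * rrH (q ^ 104)"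
    by (simp add: rrU_def power_mult[symmetric])
  moreover have "rrG (q ^ 16) * theta 24 8 (- 1) q = theta 40 8 (- 1) q" "rrH (q ^ 16) * theta 24 8 (- 1) q = theta 40 24 (- 1) q"
    "rrG (q ^ 104) * theta 156 52 (- 1) q = theta 260 52 (- 1) q" "rrH (q ^ 104) * theta 156 52 (- 1) q = theta 260 156 (- 1) q"
    using rrG_q[OF q, of 8] rrH_q[OF q, of 8] rrG_q[OF q, of 52] rrH_q[OF q, of 52] eulerE_q[OF q, of 8] eulerE_q[OF q, of 52]
    by simp_all
  moreover have "b * b' * (u * u' + c * v * v') = (u * b) * (u' * b') + c * ((v * b) * (v' * b'))" for b b' c u u' v v' :: complex
    by algebra
  ultimately show ?thesis by (simp only:)
qed

lemma rrU_1_26: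
  "theta 12 4 (- 1) q * theta 312 104 (- 1) q * rrU 1 26 (q ^ 8) =
    theta 20 12 (- 1) q * theta 520 104 (- 1) q - q ^ 40 * (theta 20 4 (- 1) q * theta 520 312 (- 1) q)"
proof -
  have "rrU 1 26 (q ^ 8) = rrH (q ^ 8) * rrG (q ^ 208) - q ^ 40 * rrG (q ^ 8) * rrH (q ^ 208)"
    by (simp add: rrU_def power_mult[symmetric])
  moreover have "rrG (q ^ 8) * theta 12 4 (- 1) q = theta 20 4 (- 1) q" "rrH (q ^ 8) * theta 12 4 (- 1) q = theta 20 12 (- 1) q"
    "rrG (q ^ 208) * theta 312 104 (- 1) q = theta 520 104 (- 1) q" "rrH (q ^ 208) * theta 312 104 (- 1) q = theta 520 312 (- 1) q"
    using rrG_q[OF q, of 4] rrH_q[OF q, of 4] rrG_q[OF q, of 104] rrH_q[OF q, of 104] eulerE_q[OF q, of 4] eulerE_q[OF q, of 104]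
    by simp_all
  moreover have "b * b' * (u * u' - c * v * v') = (u * b) * (u' * b') - c * ((v * b) * (v' * b'))" for b b' c u u' v v' :: complex
    by algebra
  ultimately show ?thesis by (simp only:)
qed

lemma theta_products_nonzero:
  "theta 24 8 (- 1) q * theta 156 52 (- 1) q \<noteq> 0" "theta 12 4 (- 1) q * theta 312 104 (- 1) q \<noteq> 0"
  using theta_nonzero[OF q, of 8] theta_nonzero[OF q, of 52] theta_nonzero[OF q, of 4] theta_nonzero[OF q, of 104] by simp_all

lemma alt_bqseries_3_rrU: "alt_bqseries 2 1 3 8 40 q = 2 * q ^ 3 * (theta 24 8 (- 1) q * theta 156 52 (- 1) q) * rrU 2 13 (q ^ 8)"
  unfolding alt_bqseries_3[OF q] rrU_2_13[symmetric] by (simp only: mult_ac)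

lemma alt_bqseries_7_rrU: "alt_bqseries 2 1 7 12 20 q = 2 * q ^ 7 * (theta 12 4 (- 1) q * theta 312 104 (- 1) q) * rrU 1 26 (q ^ 8)"
  unfolding alt_bqseries_7[OF q] rrU_1_26[symmetric] by (simp only: mult_ac)

lemma rrU_1_26_eq_2_13: "rrU 1 26 (q ^ 8) = rrU 2 13 (q ^ 8)"
proof -
  have "q ^ 7 = q ^ 4 * q ^ 3" by (simp flip: power_add)
  then show ?thesis
    using alt_bqseries_cross_product[OF q] theta_products_nonzero q(2) unfolding alt_bqseries_3_rrU alt_bqseries_7_rrU by auto
qed

lemma alt_bqseries_1_9_rrU: "alt_bqseries 2 1 1 0 104 q - alt_bqseries 2 1 9 4 12 q = 2 * q * (theta 24 8 (- 1) q * theta 156 52 (- 1) q) * (rrU 2 13 (q ^ 8))\<^sup>2"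
proof -
  have "(alt_bqseries 2 1 1 0 104 q - alt_bqseries 2 1 9 4 12 q) * (theta 24 8 (- 1) q * theta 156 52 (- 1) q) =
    2 * q * (theta 40 8 (- 1) q * theta 260 52 (- 1) q + q ^ 24 * (theta 40 24 (- 1) q * theta 260 156 (- 1) q))\<^sup>2"
    using square_of_dissections[where c = "q ^ 24", OF dissection_q[OF q, of 8] dissection_q[OF q, of 52] theta_rr_product_q[OF q, of 8] theta_rr_product_q[OF q, of 52]]
    unfolding alt_bqseries_1_9[OF q] by (simp add: mult.assoc power_mult[symmetric])
  also have "\<dots> = (2 * q * (theta 24 8 (- 1) q * theta 156 52 (- 1) q) * (rrU 2 13 (q ^ 8))\<^sup>2) * (theta 24 8 (- 1) q * theta 156 52 (- 1) q)"
    unfolding rrU_2_13[symmetric] by (simp add: power2_eq_square mult_ac)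
  finally show ?thesis using theta_products_nonzero(1) by (simp only: mult_cancel_right) simp
qed

lemma alt_bqseries_5_13_rrU: "alt_bqseries 2 1 5 8 24 q - alt_bqseries 2 1 13 0 8 q = 2 * q ^ 5 * (theta 12 4 (- 1) q * theta 312 104 (- 1) q) * (rrU 1 26 (q ^ 8))\<^sup>2"
proof -
  have rr: "theta 20 12 (- 1) q * theta 20 4 (- 1) q = theta 12 4 (- 1) q * theta 60 20 (- 1) q"
    using theta_rr_product_q[OF q, of 4] by (simp add: mult.commute)
  have d: "(theta 60 28 (- 1) q + q ^ 16 * theta 60 68 (- 1) q) * theta 12 4 (- 1) q = (theta 20 12 (- 1) q)\<^sup>2"
    "(theta 60 4 (- 1) q + q ^ 8 * theta 60 44 (- 1) q) * theta 12 4 (- 1) q = (theta 20 4 (- 1) q)\<^sup>2"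
    "(theta 1560 104 (- 1) q + q ^ 208 * theta 1560 1144 (- 1) q) * theta 312 104 (- 1) q = (theta 520 104 (- 1) q)\<^sup>2"
    "(theta 1560 728 (- 1) q + q ^ 416 * theta 1560 1768 (- 1) q) * theta 312 104 (- 1) q = (theta 520 312 (- 1) q)\<^sup>2"
    "theta 520 104 (- 1) q * theta 520 312 (- 1) q = theta 312 104 (- 1) q * theta 1560 520 (- 1) q"
    using dissection_q[OF q, of 4] dissection_q[OF q, of 104] theta_rr_product_q[OF q, of 104] by simp_all
  have "(alt_bqseries 2 1 5 8 24 q - alt_bqseries 2 1 13 0 8 q) * (theta 12 4 (- 1) q * theta 312 104 (- 1) q) =
    2 * q ^ 5 * (theta 20 12 (- 1) q * theta 520 104 (- 1) q - q ^ 40 * (theta 20 4 (- 1) q * theta 520 312 (- 1) q))\<^sup>2"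
    \<comment> \<open>U(1, 26) pairs H at x with G at x^26, so the two dissection parts at x enter
      in exchanged roles.\<close>
    using square_of_dissections[where c = "- (q ^ 40)", OF d(1,2,3,4) rr d(5)]
    unfolding alt_bqseries_5_13[OF q] by (simp add: mult.assoc power_mult[symmetric])
  also have "\<dots> = (2 * q ^ 5 * (theta 12 4 (- 1) q * theta 312 104 (- 1) q) * (rrU 1 26 (q ^ 8))\<^sup>2) * (theta 12 4 (- 1) q * theta 312 104 (- 1) q)"
    unfolding rrU_1_26[symmetric] by (simp add: power2_eq_square mult_ac)
  finally show ?thesis using theta_products_nonzero(2) by (simp only: mult_cancel_right) simp
qed

section \<open>Numerators, denominators and their quotients\<close>

lemma den_eq:
  "den1 q = 2 * q * (theta 24 8 (- 1) q * theta 156 52 (- 1) q) * (rrU 2 13 (q ^ 8))\<^sup>2"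
  "den2 q = 2 * q ^ 5 * (theta 24 8 (- 1) q * theta 156 52 (- 1) q)"
  "den3 q = 2 * q ^ 3 * (theta 24 8 (- 1) q * theta 156 52 (- 1) q) * rrU 2 13 (q ^ 8)"
proof -
  have "den1 q = alt_bqseries 2 1 1 0 104 q - alt_bqseries 2 1 9 4 12 q"
    unfolding den1_def bqseries_alt_bqseries[OF q, symmetric] by simp
  then show "den1 q = 2 * q * (theta 24 8 (- 1) q * theta 156 52 (- 1) q) * (rrU 2 13 (q ^ 8))\<^sup>2"
    unfolding alt_bqseries_1_9_rrU .
  show "den2 q = 2 * q ^ 5 * (theta 24 8 (- 1) q * theta 156 52 (- 1) q)"
    unfolding den2_def bqseries_alt_bqseries[OF q] alt_bqseries_5[OF q] ..
  show "den3 q = 2 * q ^ 3 * (theta 24 8 (- 1) q * theta 156 52 (- 1) q) * rrU 2 13 (q ^ 8)"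
    unfolding den3_def bqseries_alt_bqseries[OF q] alt_bqseries_3_rrU ..
qed

lemma num_eq:
  "num1 q = 2 * q ^ 5 * (theta 12 4 (- 1) q * theta 312 104 (- 1) q) * (rrU 1 26 (q ^ 8))\<^sup>2"
  "num2 q = 2 * q ^ 9 * (theta 12 4 (- 1) q * theta 312 104 (- 1) q)"
  "num3 q = 2 * q ^ 7 * (theta 12 4 (- 1) q * theta 312 104 (- 1) q) * rrU 1 26 (q ^ 8)"
proof -
  have "num1 q = alt_bqseries 2 1 5 8 24 q - alt_bqseries 2 1 13 0 8 q"
    unfolding num1_def bqseries_alt_bqseries[OF q, symmetric] by simp
  then show "num1 q = 2 * q ^ 5 * (theta 12 4 (- 1) q * theta 312 104 (- 1) q) * (rrU 1 26 (q ^ 8))\<^sup>2"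
    unfolding alt_bqseries_5_13_rrU .
  show "num2 q = 2 * q ^ 9 * (theta 12 4 (- 1) q * theta 312 104 (- 1) q)"
    unfolding num2_def bqseries_alt_bqseries[OF q] alt_bqseries_9[OF q] ..
  show "num3 q = 2 * q ^ 7 * (theta 12 4 (- 1) q * theta 312 104 (- 1) q) * rrU 1 26 (q ^ 8)"
    unfolding num3_def bqseries_alt_bqseries[OF q] alt_bqseries_7_rrU ..
qed

lemma num_den_psi_phi:
  "num1 q = den2 q - 2 * q ^ 13 * rampsi (q ^ 104) * ramphi (- (q ^ 8))"
  "den1 q = 2 * q * rampsi (q ^ 8) * ramphi (- (q ^ 104)) - num2 q"
proof -
  have "num1 q = den2 q - alt_bqseries 2 1 13 0 8 q"
    unfolding num1_def den2_def bqseries_alt_bqseries[OF q, symmetric] by simp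
  then show "num1 q = den2 q - 2 * q ^ 13 * rampsi (q ^ 104) * ramphi (- (q ^ 8))"
    unfolding alt_bqseries_13[OF q] .
  have "den1 q = alt_bqseries 2 1 1 0 104 q - num2 q"
    unfolding den1_def num2_def bqseries_alt_bqseries[OF q, symmetric] by simp
  then show "den1 q = 2 * q * rampsi (q ^ 8) * ramphi (- (q ^ 104)) - num2 q"
    unfolding alt_bqseries_1[OF q] .
qed

text \<open>In each pair, numerator and denominator contain the same power of U, namely 2, 0 and 1,
  because U(1, 26) = U(2, 13); their powers of q differ by q^4.\<close>

lemma quotient_eq:
  defines "w \<equiv> q ^ 4 * ((theta 12 4 (- 1) q * theta 312 104 (- 1) q) / (theta 24 8 (- 1) q * theta 156 52 (- 1) q))"
  shows "den1 q \<noteq> 0 \<Longrightarrow> num1 q / den1 q = w" "den2 q \<noteq> 0 \<Longrightarrow> num2 q / den2 q = w" "den3 q \<noteq> 0 \<Longrightarrow> num3 q / den3 q = w"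
proof -
  have p: "q ^ 5 = q * q ^ 4" "q ^ 9 = q ^ 5 * q ^ 4" "q ^ 7 = q ^ 3 * q ^ 4" by (simp_all flip: power_add power_Suc)
  show "num1 q / den1 q = w" if "den1 q \<noteq> 0"
    using that unfolding den_eq num_eq w_def rrU_1_26_eq_2_13 p(1) by (simp add: field_simps)
  show "num2 q / den2 q = w" if "den2 q \<noteq> 0"
    using that unfolding den_eq num_eq w_def p(2) by (simp add: field_simps)
  show "num3 q / den3 q = w" if "den3 q \<noteq> 0"
    using that unfolding den_eq num_eq w_def rrU_1_26_eq_2_13 p(3) by (simp add: field_simps)
qed

end

text \<open>Away from 0 the denominators can vanish only through U(2, 13). \<open>T\<close> is E_2
  E_13 U(2, 13) written in theta series, which shows its holomorphy at 0 as well; the value 1 there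
  rules out that it vanishes identically.\<close>

lemma eventually_den_nonzero: "\<forall>\<^sub>\<approx>z\<in>ball 0 1. den1 z \<noteq> 0 \<and> den2 z \<noteq> 0 \<and> den3 z \<noteq> 0"
proof -
  define T where "T = (\<lambda>z. theta 40 8 (- 1) z * theta 260 52 (- 1) z + z ^ 24 * (theta 40 24 (- 1) z * theta 260 156 (- 1) z))"
  have h: "T holomorphic_on ball 0 1"
    unfolding T_def by (intro holomorphic_intros theta_holomorphic) auto
  have "isCont T 0"
    by (rule continuous_on_interior[OF holomorphic_on_imp_continuous_on[OF h]]) simp
  moreover have "T 0 = 1" by (simp add: T_def theta_0)
  ultimately have ev: "\<forall>\<^sub>F z in at 0. T z \<noteq> 0"
    using tendsto_imp_eventually_ne[of T 1 "at 0" 0] by (simp add: isCont_def)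
  have "T meromorphic_on ball 0 1"
    by (intro analytic_on_imp_meromorphic_on) (simp add: analytic_on_open h)
  \<comment> \<open>The disc is connected, so a meromorphic function on it takes the value 0 either
    almost everywhere or on a sparse set only.\<close>
  then have "(\<forall>\<^sub>\<approx>z\<in>ball 0 1. T z = 0) \<or> (\<forall>\<^sub>\<approx>z\<in>ball 0 1. T z \<noteq> 0)"
    by (rule meromorphic_imp_constant_or_avoid) auto
  moreover have "\<not> (\<forall>\<^sub>\<approx>z\<in>ball 0 1. T z = 0)"
  proof
    assume "\<forall>\<^sub>\<approx>z\<in>ball 0 1. T z = 0"
    then have "\<forall>\<^sub>F z in at 0. T z = 0"
      by (rule eventually_cosparse_imp_eventually_at) simp
    with ev have "\<forall>\<^sub>F z in at (0 :: complex). False" by eventually_elim simp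
    then show False by simp
  qed
  ultimately have "\<forall>\<^sub>\<approx>z\<in>ball 0 1. T z \<noteq> 0" by blast
  moreover have "\<forall>\<^sub>\<approx>z\<in>ball 0 1. z \<noteq> (0 :: complex)"
    by (subst eventually_cosparse_open_eq) (auto intro: eventually_neq_at_within)
  moreover have "\<forall>\<^sub>\<approx>z\<in>ball 0 1. z \<in> ball (0 :: complex) 1"
    by (rule eventually_in_cosparse) auto
  ultimately show ?thesis
  proof eventually_elim
    case (elim z)
    then have z: "norm z < 1" "z \<noteq> 0" by auto
    from elim(1) have "rrU 2 13 (z ^ 8) \<noteq> 0"
      using rrU_2_13[OF z] by (auto simp: T_def)
    then show ?case
      using z theta_products_nonzero[OF z] by (simp add: den_eq[OF z])
  qed
qed

theorem theorem4p7:
  fixes q Q :: complex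
  assumes "norm q < 1" and "Q = q ^ 13"
  shows "(2 * q ^ 3 * eulerE (q ^ 16) * eulerE (Q ^ 8) * rrU 2 13 (q ^ 8)
           = bqseries 3 2 139 q - bqseries 12 4 35 q) \<and>
         (2 * q ^ 7 * eulerE (q ^ 8) * eulerE (Q ^ 16) * rrU 1 26 (q ^ 8)
           = bqseries 7 4 60 q - bqseries 15 4 28 q) \<and>
         (2 * q ^ 9 * eulerE (q ^ 8) * eulerE (Q ^ 16)
           = bqseries 9 8 48 q - bqseries 17 6 25 q) \<and>
         (2 * q ^ 5 * eulerE (q ^ 16) * eulerE (Q ^ 8)
           = bqseries 5 4 84 q - bqseries 20 4 21 q) \<and>
         (2 * q ^ 5 * eulerE (q ^ 8) * eulerE (Q ^ 16) * (rrU 1 26 (q ^ 8))\<^sup>2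
           = bqseries 5 4 84 q + bqseries 21 10 21 q - bqseries 13 0 32 q - bqseries 20 4 21 q) \<and>
         (bqseries 5 4 84 q + bqseries 21 10 21 q - bqseries 13 0 32 q - bqseries 20 4 21 q
           = 2 * q ^ 5 * eulerE (q ^ 16) * eulerE (Q ^ 8)
             - 2 * q ^ 13 * rampsi (Q ^ 8) * ramphi (- (q ^ 8))) \<and>
         (2 * q * eulerE (q ^ 16) * eulerE (Q ^ 8) * (rrU 2 13 (q ^ 8))\<^sup>2
           = bqseries 1 0 416 q + bqseries 17 6 25 q - bqseries 4 4 105 q - bqseries 9 8 48 q) \<and>
         (bqseries 1 0 416 q + bqseries 17 6 25 q - bqseries 4 4 105 q - bqseries 9 8 48 q
           = 2 * q * rampsi (q ^ 8) * ramphi (- (Q ^ 8))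
             - 2 * q ^ 9 * eulerE (q ^ 8) * eulerE (Q ^ 16)) \<and>
         (\<forall>\<^sub>\<approx>z\<in>ball 0 1. den1 z \<noteq> 0 \<and> den2 z \<noteq> 0 \<and> den3 z \<noteq> 0) \<and>
         (den1 q \<noteq> 0 \<longrightarrow> den2 q \<noteq> 0 \<longrightarrow> num1 q / den1 q = num2 q / den2 q) \<and>
         (den2 q \<noteq> 0 \<longrightarrow> den3 q \<noteq> 0 \<longrightarrow> num2 q / den2 q = num3 q / den3 q) \<and>
         (den3 q \<noteq> 0 \<longrightarrow> num3 q / den3 q
           = q ^ 4 * (eulerE (q ^ 8) * eulerE (Q ^ 16) / (eulerE (q ^ 16) * eulerE (Q ^ 8)))) \<and>
         (den2 q \<noteq> 0 \<longrightarrow> num2 q / den2 q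
           = q ^ 4 * (eulerE (q ^ 8) * eulerE (Q ^ 16) / (eulerE (q ^ 16) * eulerE (Q ^ 8)))) \<and>
         (den1 q \<noteq> 0 \<longrightarrow> num1 q / den1 q
           = q ^ 4 * (eulerE (q ^ 8) * eulerE (Q ^ 16) / (eulerE (q ^ 16) * eulerE (Q ^ 8))))"
proof (cases "q = 0")
  case True
  \<comment> \<open>At the origin every series (a, b, c) equals 1, so all differences vanish and the
    clauses about quotients are vacuous. This case is separate because the theta manipulations use
    negative powers of q.\<close>
  have "den1 0 = 0" "den2 0 = 0" "den3 0 = 0"
    by (simp_all add: den1_def den2_def den3_def bqseries_0)
  then show ?thesis
    using eventually_den_nonzero assms(2) True by (simp add: bqseries_0)
next
  case False
  note q = assms(1) False
  have Q: "Q ^ 8 = q ^ 104" "Q ^ 16 = q ^ 208" by (simp_all add: assms(2) power_mult[symmetric])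
  have E: "eulerE (q ^ 8) = theta 12 4 (- 1) q" "eulerE (q ^ 16) = theta 24 8 (- 1) q"
    "eulerE (q ^ 104) = theta 156 52 (- 1) q" "eulerE (q ^ 208) = theta 312 104 (- 1) q"
    using eulerE_q[OF q, of 4] eulerE_q[OF q, of 8] eulerE_q[OF q, of 52] eulerE_q[OF q, of 104] by simp_all
  note quotient = quotient_eq[OF q]
  have 3: "2 * q ^ 3 * eulerE (q ^ 16) * eulerE (Q ^ 8) * rrU 2 13 (q ^ 8) = den3 q"
    "2 * q ^ 7 * eulerE (q ^ 8) * eulerE (Q ^ 16) * rrU 1 26 (q ^ 8) = num3 q"
    and 2: "2 * q ^ 9 * eulerE (q ^ 8) * eulerE (Q ^ 16) = num2 q"
    "2 * q ^ 5 * eulerE (q ^ 16) * eulerE (Q ^ 8) = den2 q"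
    and 1: "2 * q ^ 5 * eulerE (q ^ 8) * eulerE (Q ^ 16) * (rrU 1 26 (q ^ 8))\<^sup>2 = num1 q"
    "2 * q * eulerE (q ^ 16) * eulerE (Q ^ 8) * (rrU 2 13 (q ^ 8))\<^sup>2 = den1 q"
    unfolding Q E den_eq[OF q] num_eq[OF q] by (simp_all only: mult.assoc)
  have 4: "num1 q = den2 q - 2 * q ^ 13 * rampsi (Q ^ 8) * ramphi (- (q ^ 8))"
    "den1 q = 2 * q * rampsi (q ^ 8) * ramphi (- (Q ^ 8)) - num2 q"
    unfolding Q by (rule num_den_psi_phi[OF q])+
  have 5: "den1 q \<noteq> 0 \<longrightarrow> num1 q / den1 q = q ^ 4 * (eulerE (q ^ 8) * eulerE (Q ^ 16) / (eulerE (q ^ 16) * eulerE (Q ^ 8)))"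
    "den2 q \<noteq> 0 \<longrightarrow> num2 q / den2 q = q ^ 4 * (eulerE (q ^ 8) * eulerE (Q ^ 16) / (eulerE (q ^ 16) * eulerE (Q ^ 8)))"
    "den3 q \<noteq> 0 \<longrightarrow> num3 q / den3 q = q ^ 4 * (eulerE (q ^ 8) * eulerE (Q ^ 16) / (eulerE (q ^ 16) * eulerE (Q ^ 8)))"
    unfolding Q E using quotient by blast+
  show ?thesis
    unfolding 1 2 3
    using 4 5 eventually_den_nonzero
    unfolding num1_def[symmetric] num2_def[symmetric] num3_def[symmetric] den1_def[symmetric] den2_def[symmetric] den3_def[symmetric]
    by simp
qed

end
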